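(* For each $\mathcal{L}_{\Diamond\exists}$-formula $\varphi$, $$\varphi\in\mathbf{M}^+\mathbf{GrzB}\iff\varphi^+\in\mathbf{MGLB}.$$
   Context: $\mathcal{L}_{\Diamond\exists}$ is the propositional language with two modalities $\Diamond,\exists$, with $\Box=\neg\Diamond\neg$ and $\forall=\neg\exists\neg$. $\mathbf{GL}=\mathbf{K}+\Box(\Box p\to p)\to\Box p$ and $\mathbf{Grz}=\mathbf{K}+\Box(\Box(p\to\Box p)\to p)\to p$ (in modality $\Diamond$), and $\mathbf{S5}$ is formulated in modality $\exists$. For a unimodal logic $\mathbf{L}$, the fusion $\mathbf{L}\otimes\mathbf{S5}$ is the least set of $\mathcal{L}_{\Diamond\exists}$-formulae containing the theorems of $\mathbf{L}$ and of $\mathbf{S5}$ and closed under Modus Ponens, Substitution, $\Box$-necessitation, and $\forall$-necessitation; "$+$" denotes the least extension containing the given formulae and closed under the same rules. Put $$\mathbf{MLB}=(\mathbf{L}\otimes\mathbf{S5})+(\exists\Diamond p\to\Diamond\exists p)+(\Diamond\exists p\to\exists\Diamond p)$$ (giving $\mathbf{MGLB}$ and $\mathbf{MGrzB}$), and $$\mathbf{M}^+\mathbf{GrzB}=\mathbf{MGrzB}+\Box\forall(\Box(\Box p\to\Box\forall p)\to\Box\forall p)\to\Box\forall p.$$ The translation $\varphi\mapsto\varphi^+$ replaces each occurrence of $\Box$ by $\Box^+$, where $\Box^+\psi=\psi\wedge\Box\psi$; equivalently, it fixes propositional letters, commutes with Boolean connectives and $\exists$, and $(\Diamond\psi)^+=\psi^+\vee\Diamond\psi^+$.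 *)

theory Defs
  imports Main
begin

text \<open>
  Formulae over a type \<open>'m\<close> of modalities, in countably many propositional letters.
  Diamonds are primitive, one for each element of \<open>'m\<close>; the Boolean connectives are generated
  by falsum and implication.
\<close>

datatype 'm fm = Var nat | Bot | Imp "'m fm" "'m fm" (infixr \<open>\<^bold>\<longrightarrow>\<close> 55) | Dia 'm "'m fm"

abbreviation Neg :: "'m fm \<Rightarrow> 'm fm" where
  "Neg a \<equiv> a \<^bold>\<longrightarrow> Bot"

abbreviation Or :: "'m fm \<Rightarrow> 'm fm \<Rightarrow> 'm fm" where
  "Or a b \<equiv> Neg a \<^bold>\<longrightarrow> b"

abbreviation Box :: "'m \<Rightarrow> 'm fm \<Rightarrow> 'm fm" where
  "Box m a \<equiv> Neg (Dia m (Neg a))"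

primrec subst :: "(nat \<Rightarrow> 'm fm) \<Rightarrow> 'm fm \<Rightarrow> 'm fm" where
  "subst s (Var n) = s n"
| "subst s Bot = Bot"
| "subst s (a \<^bold>\<longrightarrow> b) = subst s a \<^bold>\<longrightarrow> subst s b"
| "subst s (Dia m a) = Dia m (subst s a)"

text \<open>The Boolean value of a formula when letters and formulae \<open>Dia m a\<close> are treated as atoms.\<close>

primrec bval :: "('m fm \<Rightarrow> bool) \<Rightarrow> 'm fm \<Rightarrow> bool" where
  "bval v (Var n) = v (Var n)"
| "bval v Bot = False"
| "bval v (a \<^bold>\<longrightarrow> b) = (bval v a \<longrightarrow> bval v b)"
| "bval v (Dia m a) = v (Dia m a)"

definition tautology :: "'m fm \<Rightarrow> bool" where
  "tautology a \<longleftrightarrow> (\<forall>v. bval v a)"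

text \<open>
  The least set of formulae containing \<open>G\<close> and closed under Modus Ponens, Substitution, and
  necessitation for every modality in \<open>'m\<close>.
\<close>

inductive_set nclosure :: "'m fm set \<Rightarrow> 'm fm set" for G :: "'m fm set" where
  base: "a \<in> G \<Longrightarrow> a \<in> nclosure G"
| mp: "a \<^bold>\<longrightarrow> b \<in> nclosure G \<Longrightarrow> a \<in> nclosure G \<Longrightarrow> b \<in> nclosure G"
| sub: "a \<in> nclosure G \<Longrightarrow> subst s a \<in> nclosure G"
| nec: "a \<in> nclosure G \<Longrightarrow> Box m a \<in> nclosure G"

definition extend :: "'m fm set \<Rightarrow> 'm fm set \<Rightarrow> 'm fm set" (infixl \<open>\<^bold>+\<close> 65) where
  "L \<^bold>+ A = nclosure (L \<union> A)"

abbreviation p0 :: "'m fm" where "p0 \<equiv> Var 0"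
abbreviation q0 :: "'m fm" where "q0 \<equiv> Var 1"

text \<open>Unimodal logics are sets of formulae over the one-element type of modalities.\<close>

abbreviation udia :: "unit fm \<Rightarrow> unit fm" where "udia \<equiv> Dia ()"
abbreviation ubox :: "unit fm \<Rightarrow> unit fm" where "ubox \<equiv> Box ()"

text \<open>
  As diamonds are primitive, the basic normal logic needs the duality axioms
  (the last two below, jointly \<open>udia p0 \<longleftrightarrow> \<not> ubox (\<not> p0)\<close>) besides the distribution axiom: since
  \<open>ubox a\<close> is literally \<open>\<not> udia (\<not> a)\<close>, distribution and necessitation alone do not relate
  \<open>udia p0\<close> to \<open>udia (\<not> \<not> p0)\<close>.
\<close>

definition logK :: "unit fm set" where
  "logK = nclosure ({a. tautology a} \<union>
     {ubox (p0 \<^bold>\<longrightarrow> q0) \<^bold>\<longrightarrow> (ubox p0 \<^bold>\<longrightarrow> ubox q0),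
      udia p0 \<^bold>\<longrightarrow> Neg (ubox (Neg p0)),
      Neg (ubox (Neg p0)) \<^bold>\<longrightarrow> udia p0})"

definition GL :: "unit fm set" where
  "GL = logK \<^bold>+ {ubox (ubox p0 \<^bold>\<longrightarrow> p0) \<^bold>\<longrightarrow> ubox p0}"

definition Grz :: "unit fm set" where
  "Grz = logK \<^bold>+ {ubox (ubox (p0 \<^bold>\<longrightarrow> ubox p0) \<^bold>\<longrightarrow> p0) \<^bold>\<longrightarrow> p0}"

definition S5 :: "unit fm set" where
  "S5 = logK \<^bold>+ {ubox p0 \<^bold>\<longrightarrow> p0, ubox p0 \<^bold>\<longrightarrow> ubox (ubox p0), udia p0 \<^bold>\<longrightarrow> ubox (udia p0)}"

datatype modality = Poss | Exi

type_synonym bfm = "modality fm"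

abbreviation bdia :: "bfm \<Rightarrow> bfm" (\<open>\<diamond>_\<close> [80] 80) where "\<diamond>a \<equiv> Dia Poss a"
abbreviation bbox :: "bfm \<Rightarrow> bfm" (\<open>\<box>_\<close> [80] 80) where "\<box>a \<equiv> Box Poss a"
abbreviation bex :: "bfm \<Rightarrow> bfm" (\<open>\<^bold>\<exists>_\<close> [80] 80) where "\<^bold>\<exists>a \<equiv> Dia Exi a"
abbreviation ball :: "bfm \<Rightarrow> bfm" (\<open>\<^bold>\<forall>_\<close> [80] 80) where "\<^bold>\<forall>a \<equiv> Box Exi a"

text \<open>The theorems of \<open>L\<close> are read with \<open>\<diamond>\<close> as their modality, those of \<open>S5\<close> with \<open>\<^bold>\<exists>\<close>.\<close>

definition fusion_S5 :: "unit fm set \<Rightarrow> bfm set" where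
  "fusion_S5 L = nclosure (map_fm (\<lambda>_. Poss) ` L \<union> map_fm (\<lambda>_. Exi) ` S5)"

definition MB :: "unit fm set \<Rightarrow> bfm set" where
  "MB L = fusion_S5 L \<^bold>+ {\<^bold>\<exists>\<diamond>p0 \<^bold>\<longrightarrow> \<diamond>\<^bold>\<exists>p0} \<^bold>+ {\<diamond>\<^bold>\<exists>p0 \<^bold>\<longrightarrow> \<^bold>\<exists>\<diamond>p0}"

definition MGLB :: "bfm set" where "MGLB = MB GL"

definition MGrzB :: "bfm set" where "MGrzB = MB Grz"

definition MplusGrzB :: "bfm set" where
  "MplusGrzB = MGrzB \<^bold>+
     {\<box>\<^bold>\<forall>(\<box>(\<box>p0 \<^bold>\<longrightarrow> \<box>\<^bold>\<forall>p0) \<^bold>\<longrightarrow> \<box>\<^bold>\<forall>p0) \<^bold>\<longrightarrow> \<box>\<^bold>\<forall>p0}"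

fun plus_trans :: "bfm \<Rightarrow> bfm" where
  "plus_trans (Var n) = Var n"
| "plus_trans Bot = Bot"
| "plus_trans (a \<^bold>\<longrightarrow> b) = plus_trans a \<^bold>\<longrightarrow> plus_trans b"
| "plus_trans (\<diamond>a) = Or (plus_trans a) (\<diamond>(plus_trans a))"
| "plus_trans (\<^bold>\<exists>a) = \<^bold>\<exists>(plus_trans a)"

end

theory Submission
  imports Defs "HOL-Library.Countable"
begin

text \<open>
  Left to right, the axioms are checked in the canonical frame of \<open>MGLB\<close>, where Loeb's axiom
  provides, above any point of a definable set, a last point of that set.

  Right to left, suppose \<open>\<phi>\<close> fails in the canonical frame of \<open>MplusGrzB\<close>. Relative to the finite set
  of subformulae of \<open>\<phi>\<close>, a point has a type and a cluster of \<open>\<exists>\<close> has a set of types, its cluster type.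
  The axiom of \<open>MplusGrzB\<close> yields, above every cluster, a full one with the same cluster type: each
  of its types is realized by a point that can change its type only by leaving the cluster type for
  good. On the full clusters, let \<open>x \<prec> y\<close> mean that the cluster of \<open>y\<close> is above that of \<open>x\<close>, that the
  cluster type of \<open>x\<close> never occurs again above \<open>y\<close>, and that the type of \<open>y\<close> may follow that of \<open>x\<close>.
  The finitely many cluster types make \<open>\<prec>\<close> conversely well-founded, so this is a frame for \<open>MGLB\<close>,
  and it refutes the translation of \<open>\<phi>\<close>.
\<close>

section \<open>Kripke soundness\<close>

text \<open>The carrier \<open>W\<close> is a set, because the frames used later consist of the
  maximal consistent sets or only of the full points among them.\<close>

primrec sat ::
  "'w set \<Rightarrow> ('m \<Rightarrow> 'w \<Rightarrow> 'w \<Rightarrow> bool) \<Rightarrow> (nat \<Rightarrow> 'w \<Rightarrow> bool) \<Rightarrow> 'w \<Rightarrow> 'm fm \<Rightarrow> bool" where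
  "sat W R V x (Var n) = V n x"
| "sat W R V x Bot = False"
| "sat W R V x (a \<^bold>\<longrightarrow> b) = (sat W R V x a \<longrightarrow> sat W R V x b)"
| "sat W R V x (Dia m a) = (\<exists>y\<in>W. R m x y \<and> sat W R V y a)"

definition valid :: "'w set \<Rightarrow> ('m \<Rightarrow> 'w \<Rightarrow> 'w \<Rightarrow> bool) \<Rightarrow> 'm fm \<Rightarrow> bool" where
  "valid W R a \<longleftrightarrow> (\<forall>V. \<forall>x\<in>W. sat W R V x a)"

lemma sat_subst: "sat W R V x (subst s a) = sat W R (\<lambda>n y. sat W R V y (s n)) x a"
  by (induction a arbitrary: x) auto

text \<open>Lets the soundness of a unimodal logic be used in either modality of the fusion.\<close>

lemma sat_map_fm: "sat W R V x (map_fm f a) = sat W (\<lambda>m. R (f m)) V x a"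
  by (induction a arbitrary: x) auto

lemma valid_map_fm: "valid W R (map_fm f a) = valid W (\<lambda>m. R (f m)) a"
  by (simp add: valid_def sat_map_fm)

lemma valid_tautology:
  assumes "tautology a"
  shows "valid W R a"
proof -
  have "bval (sat W R V x) a = sat W R V x a" for V x
    by (induction a) auto
  with assms show ?thesis
    unfolding tautology_def valid_def by metis
qed

lemma valid_nclosure:
  assumes "a \<in> nclosure G" and "\<And>b. b \<in> G \<Longrightarrow> valid W R b"
  shows "valid W R a"
  using assms(1)
proof induction
  case (sub a s)
  then show ?case by (simp add: valid_def sat_subst)
qed (auto simp: valid_def assms(2)[unfolded valid_def])

lemma valid_extend:
  assumes "a \<in> L \<^bold>+ A" and "\<And>b. b \<in> L \<Longrightarrow> valid W R b" and "\<And>b. b \<in> A \<Longrightarrow> valid W R b"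
  shows "valid W R a"
  using assms unfolding extend_def by (blast intro: valid_nclosure)

lemma valid_logK: "a \<in> logK \<Longrightarrow> valid W R a"
  unfolding logK_def by (erule valid_nclosure) (auto simp: valid_tautology, auto simp: valid_def)

lemma valid_S5:
  assumes "a \<in> S5" and "equiv W {(x, y). x \<in> W \<and> y \<in> W \<and> R () x y}"
  shows "valid W R a"
proof -
  have refl: "R () x x" if "x \<in> W" for x
    using assms(2) that by (auto simp: equiv_def refl_on_def)
  have sym: "R () y x" if "x \<in> W" "y \<in> W" "R () x y" for x y
    using assms(2) that by (auto simp: equiv_def sym_def)
  have trans: "R () x z" if "x \<in> W" "y \<in> W" "z \<in> W" "R () x y" "R () y z" for x y z
    using assms(2) that by (auto simp: equiv_def trans_def)
  show ?thesis
    using assms(1) unfolding S5_def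
  proof (rule valid_extend)
    fix b assume "b \<in> {ubox p0 \<^bold>\<longrightarrow> p0, ubox p0 \<^bold>\<longrightarrow> ubox (ubox p0), udia p0 \<^bold>\<longrightarrow> ubox (udia p0)}"
    then consider "b = ubox p0 \<^bold>\<longrightarrow> p0" | "b = ubox p0 \<^bold>\<longrightarrow> ubox (ubox p0)"
      | "b = udia p0 \<^bold>\<longrightarrow> ubox (udia p0)" by blast
    then show "valid W R b"
    proof cases
      case 1
      then show ?thesis using refl by (auto simp: valid_def)
    next
      case 2
      then show ?thesis by (simp add: valid_def) (meson trans)
    next
      case 3
      then show ?thesis by (simp add: valid_def) (meson sym trans)
    qed
  qed (rule valid_logK)
qed

lemma valid_GL:
  assumes "a \<in> GL"
    and trans: "\<And>x y z. \<lbrakk>x \<in> W; y \<in> W; z \<in> W; R () x y; R () y z\<rbrakk> \<Longrightarrow> R () x z"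
    and wf: "wf {(y, x). x \<in> W \<and> y \<in> W \<and> R () x y}"
  shows "valid W R a"
  using assms(1) unfolding GL_def
proof (rule valid_extend)
  fix b assume b: "b \<in> {ubox (ubox p0 \<^bold>\<longrightarrow> p0) \<^bold>\<longrightarrow> ubox p0}"
  have "V 0 y" if "x \<in> W" "y \<in> W" "R () x y"
    "\<forall>y\<in>W. R () x y \<longrightarrow> (\<forall>z\<in>W. R () y z \<longrightarrow> V 0 z) \<longrightarrow> V 0 y" for V :: "nat \<Rightarrow> _" and x y
    using wf that(2,3)
  proof (induction y)
    case (less y)
    \<comment> \<open>By transitivity the successors of \<open>y\<close> are successors of
      \<open>x\<close>, so the induction hypothesis covers them.\<close>
    then have "\<forall>z\<in>W. R () y z \<longrightarrow> V 0 z" using that(1) trans[of x y] by blast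
    then show ?case using less.prems that(4) by blast
  qed
  then show "valid W R b"
    using b by (simp add: valid_def) metis
qed (rule valid_logK)

text \<open>\<open>com1\<close> and \<open>com2\<close> are the first-order correspondents of the
  two interaction axioms, in the order in which \<open>MB\<close> adds them.\<close>

theorem MGLB_sound:
  assumes "a \<in> MGLB"
    and trans: "\<And>x y z. \<lbrakk>x \<in> W; y \<in> W; z \<in> W; R Poss x y; R Poss y z\<rbrakk> \<Longrightarrow> R Poss x z"
    and wf: "wf {(y, x). x \<in> W \<and> y \<in> W \<and> R Poss x y}"
    and equiv: "equiv W {(x, y). x \<in> W \<and> y \<in> W \<and> R Exi x y}"
    and com1: "\<And>x y z. \<lbrakk>x \<in> W; y \<in> W; z \<in> W; R Exi x y; R Poss y z\<rbrakk>
                 \<Longrightarrow> \<exists>w\<in>W. R Poss x w \<and> R Exi w z"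
    and com2: "\<And>x y z. \<lbrakk>x \<in> W; y \<in> W; z \<in> W; R Poss x y; R Exi y z\<rbrakk>
                 \<Longrightarrow> \<exists>w\<in>W. R Exi x w \<and> R Poss w z"
  shows "valid W R a"
  using assms(1) unfolding MGLB_def MB_def fusion_S5_def
proof (elim valid_extend valid_nclosure)
  fix b assume "b \<in> {\<^bold>\<exists>\<diamond>p0 \<^bold>\<longrightarrow> \<diamond>\<^bold>\<exists>p0}"
  then show "valid W R b"
    unfolding valid_def by auto (meson com1)
next
  fix b assume "b \<in> {\<diamond>\<^bold>\<exists>p0 \<^bold>\<longrightarrow> \<^bold>\<exists>\<diamond>p0}"
  then show "valid W R b"
    unfolding valid_def by auto (meson com2)
next
  fix b
  assume "b \<in> map_fm (\<lambda>_. Poss) ` GL \<union> map_fm (\<lambda>_. Exi) ` S5"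
  then show "valid W R b"
  proof
    assume "b \<in> map_fm (\<lambda>_. Poss) ` GL"
    then show ?thesis
      using valid_GL[of _ W "\<lambda>_. R Poss", OF _ trans wf] by (auto simp: valid_map_fm)
  next
    assume "b \<in> map_fm (\<lambda>_. Exi) ` S5"
    then show ?thesis
      using valid_S5[of _ W "\<lambda>_. R Exi", OF _ equiv] by (auto simp: valid_map_fm)
  qed
qed

section \<open>Canonical models\<close>

locale normal_logic =
  fixes L :: "'m fm set"
  assumes taut: "tautology a \<Longrightarrow> a \<in> L"
    and mp: "a \<^bold>\<longrightarrow> b \<in> L \<Longrightarrow> a \<in> L \<Longrightarrow> b \<in> L"
    and sub: "a \<in> L \<Longrightarrow> subst s a \<in> L"
    and nec: "a \<in> L \<Longrightarrow> Box m a \<in> L"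
    and K: "Box m (a \<^bold>\<longrightarrow> b) \<^bold>\<longrightarrow> (Box m a \<^bold>\<longrightarrow> Box m b) \<in> L"
    and dual1: "Dia m a \<^bold>\<longrightarrow> Neg (Box m (Neg a)) \<in> L"
    and dual2: "Neg (Box m (Neg a)) \<^bold>\<longrightarrow> Dia m a \<in> L"
begin

text \<open>A theory describes a single point, so necessitation is left out.\<close>

definition mp_closed :: "'m fm set \<Rightarrow> bool" where
  "mp_closed T \<longleftrightarrow> L \<subseteq> T \<and> (\<forall>a b. a \<^bold>\<longrightarrow> b \<in> T \<longrightarrow> a \<in> T \<longrightarrow> b \<in> T)"

definition mcs :: "'m fm set \<Rightarrow> bool" where
  "mcs x \<longleftrightarrow> mp_closed x \<and> Bot \<notin> x \<and> (\<forall>a. a \<in> x \<or> Neg a \<in> x)"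

definition can :: "'m \<Rightarrow> 'm fm set \<Rightarrow> 'm fm set \<Rightarrow> bool" where
  "can m x y \<longleftrightarrow> mcs x \<and> mcs y \<and> (\<forall>a. Box m a \<in> x \<longrightarrow> a \<in> y)"

lemma mp_closed_taut: "mp_closed T \<Longrightarrow> tautology a \<Longrightarrow> a \<in> T"
  using taut by (auto simp: mp_closed_def)

lemma mp_closed_mp: "mp_closed T \<Longrightarrow> a \<^bold>\<longrightarrow> b \<in> T \<Longrightarrow> a \<in> T \<Longrightarrow> b \<in> T"
  by (auto simp: mp_closed_def)

lemma mp_closed_L: "mp_closed L"
  using mp by (auto simp: mp_closed_def)

text \<open>The deduction theorem: this set is the theory generated by \<open>T\<close> and
  \<open>a\<close>. Weakening and self-distribution of implication are tautologies, hence the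
  closure.\<close>

lemma mp_closed_assume:
  assumes "mp_closed T"
  shows "mp_closed {b. a \<^bold>\<longrightarrow> b \<in> T}"
  unfolding mp_closed_def
proof (safe)
  fix b assume "b \<in> L"
  moreover have "b \<^bold>\<longrightarrow> a \<^bold>\<longrightarrow> b \<in> T"
    using assms by (rule mp_closed_taut) (simp add: tautology_def)
  ultimately show "a \<^bold>\<longrightarrow> b \<in> T"
    using assms unfolding mp_closed_def by blast
next
  fix b c assume "a \<^bold>\<longrightarrow> b \<^bold>\<longrightarrow> c \<in> T" "a \<^bold>\<longrightarrow> b \<in> T"
  moreover have "(a \<^bold>\<longrightarrow> b \<^bold>\<longrightarrow> c) \<^bold>\<longrightarrow> (a \<^bold>\<longrightarrow> b) \<^bold>\<longrightarrow> a \<^bold>\<longrightarrow> c \<in> T"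
    using assms by (rule mp_closed_taut) (simp add: tautology_def)
  ultimately show "a \<^bold>\<longrightarrow> c \<in> T"
    using assms mp_closed_mp by blast
qed

text \<open>Zorn's lemma on the theories that extend \<open>T\<close> and omit \<open>f\<close>; a
  maximal one is complete.\<close>

lemma Lindenbaum:
  assumes T: "mp_closed T" and f: "f \<notin> T"
  obtains x where "mcs x" "T \<subseteq> x" "f \<notin> x"
proof -
  let ?A = "{U. mp_closed U \<and> T \<subseteq> U \<and> f \<notin> U}"
  have "\<exists>M\<in>?A. \<forall>X\<in>?A. M \<subseteq> X \<longrightarrow> X = M"
  proof (rule subset_Zorn_nonempty)
    show "?A \<noteq> {}" using assms by auto
    fix \<C> assume ne: "\<C> \<noteq> {}" and ch: "subset.chain ?A \<C>"
    have sub: "\<And>U. U \<in> \<C> \<Longrightarrow> mp_closed U \<and> T \<subseteq> U \<and> f \<notin> U"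
      and lin: "\<And>U V. U \<in> \<C> \<Longrightarrow> V \<in> \<C> \<Longrightarrow> U \<subseteq> V \<or> V \<subseteq> U"
      using ch by (auto simp: subset.chain_def)
    have "mp_closed (\<Union>\<C>)"
      unfolding mp_closed_def
    proof (intro conjI allI impI)
      obtain U where "U \<in> \<C>" using ne by blast
      then show "L \<subseteq> \<Union>\<C>" using sub[of U] unfolding mp_closed_def by blast
      fix a b assume "a \<^bold>\<longrightarrow> b \<in> \<Union>\<C>" "a \<in> \<Union>\<C>"
      then obtain U V where "U \<in> \<C>" "V \<in> \<C>" "a \<^bold>\<longrightarrow> b \<in> U" "a \<in> V" by blast
      then have "\<exists>U\<in>\<C>. a \<^bold>\<longrightarrow> b \<in> U \<and> a \<in> U" using lin by blast
      then show "b \<in> \<Union>\<C>" using sub mp_closed_mp by blast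
    qed
    then show "\<Union>\<C> \<in> ?A" using sub ne by blast
  qed
  then obtain x where "x \<in> ?A" and m: "\<forall>X\<in>?A. x \<subseteq> X \<longrightarrow> X = x" by (rule bexE)
  then have x: "mp_closed x" "T \<subseteq> x" "f \<notin> x" by simp_all
  have max: "X = x" if "mp_closed X" "T \<subseteq> X" "f \<notin> X" "x \<subseteq> X" for X
    using m that by simp
  \<comment> \<open>Adding \<open>a\<close> to the maximal theory \<open>x\<close> must produce
    \<open>f\<close>. Were both \<open>a\<close> and its negation outside \<open>x\<close>, then
    \<open>f\<close> would follow by cases.\<close>
  have imp_f: "a \<^bold>\<longrightarrow> f \<in> x" if "a \<notin> x" for a
  proof (rule ccontr)
    assume "a \<^bold>\<longrightarrow> f \<notin> x"
    moreover have "x \<subseteq> {b. a \<^bold>\<longrightarrow> b \<in> x}"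
    proof safe
      fix b assume "b \<in> x"
      moreover have "b \<^bold>\<longrightarrow> a \<^bold>\<longrightarrow> b \<in> x"
        using x(1) by (rule mp_closed_taut) (simp add: tautology_def)
      ultimately show "a \<^bold>\<longrightarrow> b \<in> x" using mp_closed_mp x(1) by blast
    qed
    moreover have "a \<^bold>\<longrightarrow> a \<in> x"
      using x(1) by (rule mp_closed_taut) (simp add: tautology_def)
    ultimately show False
      using max[OF mp_closed_assume[OF x(1), of a]] x(2) that by blast
  qed
  have "Bot \<notin> x"
  proof
    assume "Bot \<in> x"
    moreover have "Bot \<^bold>\<longrightarrow> f \<in> x"
      using x(1) by (rule mp_closed_taut) (simp add: tautology_def)
    ultimately show False using x mp_closed_mp by blast
  qed
  moreover have "a \<in> x \<or> Neg a \<in> x" for a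
  proof (rule ccontr)
    assume "\<not> ?thesis"
    then have "a \<^bold>\<longrightarrow> f \<in> x" "Neg a \<^bold>\<longrightarrow> f \<in> x" using imp_f by auto
    moreover have "(a \<^bold>\<longrightarrow> f) \<^bold>\<longrightarrow> (Neg a \<^bold>\<longrightarrow> f) \<^bold>\<longrightarrow> f \<in> x"
      using x(1) by (rule mp_closed_taut) (auto simp: tautology_def)
    ultimately show False using x mp_closed_mp by blast
  qed
  ultimately show ?thesis using that x by (auto simp: mcs_def)
qed

lemma mcs_L: "mcs x \<Longrightarrow> a \<in> L \<Longrightarrow> a \<in> x"
  by (auto simp: mcs_def mp_closed_def)

lemma mem_L_iff: "a \<in> L \<longleftrightarrow> (\<forall>x. mcs x \<longrightarrow> a \<in> x)"
  using Lindenbaum[OF mp_closed_L] mcs_L by metis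

lemma mcs_Bot [simp]: "mcs x \<Longrightarrow> Bot \<notin> x"
  by (simp add: mcs_def)

lemma mcs_Imp [simp]:
  assumes "mcs x"
  shows "a \<^bold>\<longrightarrow> b \<in> x \<longleftrightarrow> (a \<in> x \<longrightarrow> b \<in> x)"
proof -
  have cl: "mp_closed x" using assms by (simp add: mcs_def)
  have "b \<^bold>\<longrightarrow> a \<^bold>\<longrightarrow> b \<in> x" "Neg a \<^bold>\<longrightarrow> a \<^bold>\<longrightarrow> b \<in> x"
    using cl by (auto intro!: mp_closed_taut simp: tautology_def)
  then show ?thesis
    using assms mp_closed_mp[OF cl] unfolding mcs_def by blast
qed

lemma can_mcs: "can m x y \<Longrightarrow> mcs x" "can m x y \<Longrightarrow> mcs y"
  by (auto simp: can_def)

lemma mcs_K: "mcs x \<Longrightarrow> Box m (a \<^bold>\<longrightarrow> b) \<in> x \<Longrightarrow> Box m a \<in> x \<Longrightarrow> Box m b \<in> x"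
  using mcs_L[OF _ K, of x m a b] by (simp del: mcs_Imp add: mcs_Imp[of x "Box m _"])

lemma mcs_Dia [simp]:
  assumes x: "mcs x"
  shows "Dia m a \<in> x \<longleftrightarrow> (\<exists>y. can m x y \<and> a \<in> y)"
proof
  assume "Dia m a \<in> x"
  then have na: "Box m (Neg a) \<notin> x"
    using mcs_L[OF x dual1[of m a]] x by (metis mcs_Imp mcs_Bot)
  \<comment> \<open>\<open>nec\<close> and \<open>K\<close> make the formulae necessary at
    \<open>x\<close> a theory. It omits \<open>Neg a\<close>, so a maximal consistent set above it
    that also omits \<open>Neg a\<close> is a successor containing \<open>a\<close>.\<close>
  let ?T = "{b. Box m b \<in> x}"
  have "mp_closed ?T"
    using mcs_L[OF x nec] mcs_K[OF x] by (auto simp only: mp_closed_def mem_Collect_eq)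
  then obtain y where "mcs y" "?T \<subseteq> y" "Neg a \<notin> y"
    using na Lindenbaum by (metis (no_types, lifting) mem_Collect_eq)
  then show "\<exists>y. can m x y \<and> a \<in> y"
    using x unfolding can_def by (metis mcs_def mem_Collect_eq subsetD)
next
  assume "\<exists>y. can m x y \<and> a \<in> y"
  then obtain y where y: "can m x y" "a \<in> y" by blast
  then have "Neg a \<notin> y" using can_mcs(2) by (metis mcs_Imp mcs_Bot)
  then have "Box m (Neg a) \<notin> x" using y unfolding can_def by blast
  then show "Dia m a \<in> x"
    using mcs_L[OF x dual2[of m a]] x by (metis mcs_Imp)
qed

text \<open>Canonicity of the two interaction axioms of \<open>MB\<close>.\<close>

lemma can_compose:
  assumes x: "mcs x" and z: "mcs z" and D: "\<And>c. c \<in> z \<Longrightarrow> Dia m (Dia n c) \<in> x"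
  obtains w where "can m x w" "can n w z"
proof -
  \<comment> \<open>The formulae that, by necessity at \<open>x\<close>, follow from some
    \<open>Dia n c\<close> with \<open>c\<close> in \<open>z\<close>. A maximal consistent set
    containing them all is a successor of \<open>x\<close> and has \<open>z\<close> as a
    successor.\<close>
  let ?T = "{b. \<exists>c\<in>z. Box m (Dia n c \<^bold>\<longrightarrow> b) \<in> x}"
  have TI: "b \<in> ?T" if "c \<in> z" "\<And>y. can m x y \<Longrightarrow> Dia n c \<in> y \<Longrightarrow> b \<in> y" for b c
    using that x by (auto simp: can_mcs dest: can_mcs intro!: bexI[of _ c])
  have TE: "\<exists>c\<in>z. \<forall>y. can m x y \<longrightarrow> Dia n c \<in> y \<longrightarrow> b \<in> y" if "b \<in> ?T" for b
  proof -
    obtain c where c: "c \<in> z" "Box m (Dia n c \<^bold>\<longrightarrow> b) \<in> x" using \<open>b \<in> ?T\<close> by blast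
    have "Dia n c \<^bold>\<longrightarrow> b \<in> y" if "can m x y" for y
      using that c unfolding can_def by blast
    then have "\<forall>y. can m x y \<longrightarrow> Dia n c \<in> y \<longrightarrow> b \<in> y"
      using can_mcs(2) mcs_Imp by blast
    then show ?thesis using c by blast
  qed
  have top: "Neg Bot \<in> z" using z by simp
  have "mp_closed ?T"
    unfolding mp_closed_def
  proof (intro conjI allI impI subsetI)
    fix b assume "b \<in> L"
    then show "b \<in> ?T" by (intro TI[OF top]) (blast intro: mcs_L can_mcs)
  next
    fix a b assume "a \<^bold>\<longrightarrow> b \<in> ?T" "a \<in> ?T"
    then obtain c d where cd: "c \<in> z" "d \<in> z"
      and c: "\<And>y. can m x y \<Longrightarrow> Dia n c \<in> y \<Longrightarrow> a \<^bold>\<longrightarrow> b \<in> y"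
      and d: "\<And>y. can m x y \<Longrightarrow> Dia n d \<in> y \<Longrightarrow> a \<in> y"
      using TE by meson
    show "b \<in> ?T"
    proof (rule TI)
      \<comment> \<open>The conjunction of \<open>c\<close> and \<open>d\<close> is a common witness
        for both premises of Modus Ponens.\<close>
      show "Neg (c \<^bold>\<longrightarrow> Neg d) \<in> z" using cd z by simp
      fix y assume y: "can m x y" and "Dia n (Neg (c \<^bold>\<longrightarrow> Neg d)) \<in> y"
      then obtain v where "can n y v" "Neg (c \<^bold>\<longrightarrow> Neg d) \<in> v"
        using can_mcs by (metis mcs_Dia)
      then have "Dia n c \<in> y" "Dia n d \<in> y"
        using can_mcs by auto
      then show "b \<in> y" using c[OF y] d[OF y] can_mcs(2)[OF y] by simp
    qed
  qed
  moreover have "Bot \<notin> ?T"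
  proof
    assume "Bot \<in> ?T"
    then obtain c where "c \<in> z" "\<And>y. can m x y \<Longrightarrow> Dia n c \<notin> y"
      using TE can_mcs mcs_Bot by meson
    then show False using D[of c] x by (metis mcs_Dia)
  qed
  ultimately obtain w where w: "mcs w" "?T \<subseteq> w" by (rule Lindenbaum)
  have "can m x w"
    unfolding can_def
  proof (intro conjI allI impI x w)
    fix a assume "Box m a \<in> x"
    then have "a \<in> y" if "can m x y" for y
      using that unfolding can_def by blast
    then have "a \<in> ?T" by (rule TI[OF top])
    then show "a \<in> w" using w by blast
  qed
  moreover have "can n w z"
    unfolding can_def
  proof (intro conjI allI impI z w)
    fix a assume a: "Box n a \<in> w"
    show "a \<in> z"
    proof (rule ccontr)
      assume "a \<notin> z"
      then have "Neg a \<in> z" using z by simp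
      then have "Dia n (Neg a) \<in> ?T" by (rule TI)
      then have "Dia n (Neg a) \<in> w" using w by blast
      then show False using a mcs_Imp[OF w(1)] mcs_Bot[OF w(1)] by blast
    qed
  qed
  ultimately show ?thesis by (rule that)
qed

lemma can_I:
  assumes "mcs x" "mcs y" "\<And>a. a \<in> y \<Longrightarrow> Dia m a \<in> x"
  shows "can m x y"
  unfolding can_def
proof (intro conjI allI impI assms(1,2))
  fix a assume "Box m a \<in> x"
  then have "Dia m (Neg a) \<notin> x"
    using mcs_Imp[OF assms(1)] mcs_Bot[OF assms(1)] by blast
  then have "Neg a \<notin> y" using assms(3) by blast
  then show "a \<in> y" using mcs_Imp[OF assms(2)] by blast
qed

section \<open>Definable properties: the admissible sets of the canonical frame\<close>

definition definable :: "('m fm set \<Rightarrow> bool) \<Rightarrow> bool" where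
  "definable P \<longleftrightarrow> (\<exists>a. \<forall>x. mcs x \<longrightarrow> (a \<in> x \<longleftrightarrow> P x))"

abbreviation csat :: "(nat \<Rightarrow> 'm fm set \<Rightarrow> bool) \<Rightarrow> 'm fm set \<Rightarrow> 'm fm \<Rightarrow> bool" where
  "csat \<equiv> sat {x. mcs x} can"

lemma canonical_truth: "mcs x \<Longrightarrow> subst s a \<in> x \<longleftrightarrow> csat (\<lambda>n y. s n \<in> y) x a"
  by (induction a arbitrary: x) (auto dest: can_mcs)

lemma mem_L_iff_csat: "a \<in> L \<longleftrightarrow> (\<forall>x. mcs x \<longrightarrow> csat (\<lambda>n y. Var n \<in> y) x a)"
proof -
  have "subst Var a = a" by (induction a) auto
  then show ?thesis using canonical_truth[of _ Var a] mem_L_iff by metis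
qed

text \<open>Substitute the defining formulae for the letters. This makes an axiom usable in the
  canonical frame for definable properties, without canonicity of the axiom.\<close>

lemma canonical_axiom:
  assumes "a \<in> L" and x: "mcs x" and "\<And>n. definable (V n)"
  shows "csat V x a"
proof -
  obtain s where s: "\<And>n x. mcs x \<Longrightarrow> s n \<in> x \<longleftrightarrow> V n x"
    using assms(3) unfolding definable_def by metis
  have "csat V x b \<longleftrightarrow> csat (\<lambda>n y. s n \<in> y) x b" if "mcs x" for b x
    using that by (induction b arbitrary: x) (auto simp: s)
  then show ?thesis
    using canonical_truth[OF x] mcs_L[OF x sub[OF assms(1)]] x by blast
qed

lemma definable_mem: "definable (\<lambda>x. a \<in> x)"
  unfolding definable_def by blast

lemma definable_imp: "definable P \<Longrightarrow> definable Q \<Longrightarrow> definable (\<lambda>x. P x \<longrightarrow> Q x)"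
  unfolding definable_def using mcs_Imp by metis

lemma definable_False: "definable (\<lambda>x. False)"
  unfolding definable_def using mcs_Bot by metis

lemma definable_not: "definable P \<Longrightarrow> definable (\<lambda>x. \<not> P x)"
  using definable_imp[OF _ definable_False, of P] by simp

lemma definable_conj: "definable P \<Longrightarrow> definable Q \<Longrightarrow> definable (\<lambda>x. P x \<and> Q x)"
  using definable_not[OF definable_imp[OF _ definable_not, of P Q]] by simp

lemma definable_iff: "definable P \<Longrightarrow> definable Q \<Longrightarrow> definable (\<lambda>x. P x \<longleftrightarrow> Q x)"
  using definable_conj[OF definable_imp definable_imp, of P Q Q P]
  by (simp add: iff_conv_conj_imp)

lemma definable_Dia:
  assumes "definable P"
  shows "definable (\<lambda>x. \<exists>y. can m x y \<and> P y)"
proof -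
  obtain a where "\<And>x. mcs x \<Longrightarrow> a \<in> x \<longleftrightarrow> P x"
    using assms unfolding definable_def by blast
  then have "\<forall>x. mcs x \<longrightarrow> (Dia m a \<in> x \<longleftrightarrow> (\<exists>y. can m x y \<and> P y))"
    using can_mcs(2) by (metis mcs_Dia)
  then show ?thesis unfolding definable_def by blast
qed

lemma definable_Ball:
  assumes "finite A" and "\<And>i. i \<in> A \<Longrightarrow> definable (P i)"
  shows "definable (\<lambda>x. \<forall>i\<in>A. P i x)"
  using assms
proof (induction A)
  case empty
  show ?case using definable_not[OF definable_False] by simp
next
  case (insert i A)
  then show ?case using definable_conj[of "P i"] by simp
qed

lemma mcs_Box:
  assumes "mcs x"
  shows "Box m a \<in> x \<longleftrightarrow> (\<forall>y. can m x y \<longrightarrow> a \<in> y)"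
proof -
  have "Neg a \<in> y \<longleftrightarrow> a \<notin> y" if "can m x y" for y
    using can_mcs(2)[OF that] by simp
  then show ?thesis using assms by auto
qed

text \<open>\<open>can\<close> only relates maximal consistent sets, so the bound over the carrier
  disappears.\<close>

lemma csat_Dia: "csat V x (Dia m a) \<longleftrightarrow> (\<exists>y. can m x y \<and> csat V y a)"
  by (auto dest: can_mcs)

lemmas csat = csat_Dia sat.simps(1-3)

lemma csat_Box: "csat V x (Box m a) \<longleftrightarrow> (\<forall>y. can m x y \<longrightarrow> csat V y a)"
  unfolding csat by blast

end

section \<open>The logics at hand\<close>

locale monadic_logic = normal_logic L for L :: "bfm set" +
  assumes Exi_T: "\<^bold>\<forall>p0 \<^bold>\<longrightarrow> p0 \<in> L"
    and Exi_5: "\<^bold>\<exists>p0 \<^bold>\<longrightarrow> \<^bold>\<forall>\<^bold>\<exists>p0 \<in> L"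
    and Exi_Poss: "\<^bold>\<exists>\<diamond>p0 \<^bold>\<longrightarrow> \<diamond>\<^bold>\<exists>p0 \<in> L"
    and Poss_Exi: "\<diamond>\<^bold>\<exists>p0 \<^bold>\<longrightarrow> \<^bold>\<exists>\<diamond>p0 \<in> L"
begin

abbreviation R (infix \<open>\<rightarrow>\<close> 50) where "x \<rightarrow> y \<equiv> can Poss x y"
abbreviation E (infix \<open>\<sim>\<close> 50) where "x \<sim> y \<equiv> can Exi x y"

lemma E_refl: "mcs x \<Longrightarrow> x \<sim> x"
proof (rule can_I)
  fix a assume x: "mcs x" and "a \<in> x"
  then show "\<^bold>\<exists>a \<in> x"
    using mcs_L[OF x sub[OF Exi_T, of "\<lambda>_. Neg a"]] by (auto simp del: mcs_Dia)
      (metis can_mcs(2) mcs_Bot mcs_Dia mcs_Imp)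
qed

text \<open>The semantic content of axiom 5; with reflexivity it makes \<open>\<sim>\<close> an
  equivalence.\<close>

lemma E_euclid:
  assumes "x \<sim> y" "x \<sim> z"
  shows "y \<sim> z"
proof (rule can_I)
  show "mcs y" "mcs z" using assms can_mcs by blast+
  fix a assume "a \<in> z"
  have x: "mcs x" using assms can_mcs by blast
  have "\<^bold>\<exists>a \<in> x" using assms \<open>a \<in> z\<close> x by auto
  then have "\<^bold>\<forall>\<^bold>\<exists>a \<in> x" using mcs_L[OF x sub[OF Exi_5, of "\<lambda>_. a"]] mcs_Imp[OF x] by simp
  then show "\<^bold>\<exists>a \<in> y" using assms(1) unfolding can_def by blast
qed

lemma E_sym: "x \<sim> y \<Longrightarrow> y \<sim> x"
  using E_euclid E_refl can_mcs by blast

lemma E_trans: "x \<sim> y \<Longrightarrow> y \<sim> z \<Longrightarrow> x \<sim> z"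
  using E_euclid E_sym by blast

text \<open>The axiom \<open>Exi_Poss\<close> is exactly what \<open>can_compose\<close> asks of the
  two endpoints; \<open>R_E\<close> uses \<open>Poss_Exi\<close> in the same way.\<close>

lemma E_R:
  assumes "x \<sim> y" "y \<rightarrow> z"
  obtains w where "x \<rightarrow> w" "w \<sim> z"
proof (rule can_compose)
  show x: "mcs x" and "mcs z" using assms can_mcs by blast+
  fix c assume "c \<in> z"
  have y: "mcs y" using assms can_mcs by blast
  have "\<diamond>c \<in> y" using assms \<open>c \<in> z\<close> y by auto
  then have "\<^bold>\<exists>\<diamond>c \<in> x" using assms mcs_Dia[OF x] by blast
  then show "\<diamond>\<^bold>\<exists>c \<in> x"
    using mcs_L[OF x sub[OF Exi_Poss, of "\<lambda>_. c"]] mcs_Imp[OF x] by simp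
qed (use that in blast)

lemma R_E:
  assumes "x \<rightarrow> y" "y \<sim> z"
  obtains w where "x \<sim> w" "w \<rightarrow> z"
proof (rule can_compose)
  show x: "mcs x" and "mcs z" using assms can_mcs by blast+
  fix c assume "c \<in> z"
  have y: "mcs y" using assms can_mcs by blast
  have "\<^bold>\<exists>c \<in> y" using assms \<open>c \<in> z\<close> y by auto
  then have "\<diamond>\<^bold>\<exists>c \<in> x" using assms mcs_Dia[OF x] by blast
  then show "\<^bold>\<exists>\<diamond>c \<in> x"
    using mcs_L[OF x sub[OF Poss_Exi, of "\<lambda>_. c"]] mcs_Imp[OF x] by simp
qed (use that in blast)

end

section \<open>From unimodal axioms to the bimodal logics\<close>

lemma extend_upper: "L \<subseteq> L \<^bold>+ A" "A \<subseteq> L \<^bold>+ A"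
  unfolding extend_def by (auto intro: nclosure.base)

instance modality :: countable by countable_datatype
instance fm :: (countable) countable by countable_datatype

text \<open>
  The tautologies in the generators of the bimodal logics are unimodal, so a bimodal tautology is
  obtained from them by substitution into its propositional skeleton.
\<close>

primrec skeleton :: "'m::countable fm \<Rightarrow> 'n fm" where
  "skeleton (Var n) = Var (to_nat (Var n :: 'm fm))"
| "skeleton Bot = Bot"
| "skeleton (a \<^bold>\<longrightarrow> b) = skeleton a \<^bold>\<longrightarrow> skeleton b"
| "skeleton (Dia m a) = Var (to_nat (Dia m a))"

lemma subst_skeleton: "subst from_nat (map_fm f (skeleton a)) = a"
  by (induction a) auto

lemma tautology_skeleton:
  assumes "tautology a"
  shows "tautology (skeleton a :: 'n fm)"
proof -
  have "bval v (skeleton a :: 'n fm) = bval (\<lambda>b. v (Var (to_nat b))) a" for v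
    by (induction a) auto
  with assms show ?thesis by (simp add: tautology_def)
qed

lemma logK_tautology: "tautology a \<Longrightarrow> a \<in> logK"
  unfolding logK_def by (auto intro: nclosure.base)

lemma MB_upper:
  "map_fm (\<lambda>_. Poss) ` U \<subseteq> MB U" "map_fm (\<lambda>_. Exi) ` S5 \<subseteq> MB U"
  "\<^bold>\<exists>\<diamond>p0 \<^bold>\<longrightarrow> \<diamond>\<^bold>\<exists>p0 \<in> MB U" "\<diamond>\<^bold>\<exists>p0 \<^bold>\<longrightarrow> \<^bold>\<exists>\<diamond>p0 \<in> MB U"
proof -
  have "map_fm (\<lambda>_. Poss) ` U \<union> map_fm (\<lambda>_. Exi) ` S5 \<subseteq> fusion_S5 U"
    unfolding fusion_S5_def by (auto intro: nclosure.base)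
  moreover have "fusion_S5 U \<subseteq> MB U"
    unfolding MB_def by (rule order_trans[OF extend_upper(1) extend_upper(1)])
  ultimately show "map_fm (\<lambda>_. Poss) ` U \<subseteq> MB U" "map_fm (\<lambda>_. Exi) ` S5 \<subseteq> MB U"
    by (meson Un_subset_iff order_trans)+
  have "{\<^bold>\<exists>\<diamond>p0 \<^bold>\<longrightarrow> \<diamond>\<^bold>\<exists>p0} \<subseteq> MB U"
    unfolding MB_def by (rule order_trans[OF extend_upper(2) extend_upper(1)])
  then show "\<^bold>\<exists>\<diamond>p0 \<^bold>\<longrightarrow> \<diamond>\<^bold>\<exists>p0 \<in> MB U" by simp
  have "{\<diamond>\<^bold>\<exists>p0 \<^bold>\<longrightarrow> \<^bold>\<exists>\<diamond>p0} \<subseteq> MB U"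
    unfolding MB_def by (rule extend_upper)
  then show "\<diamond>\<^bold>\<exists>p0 \<^bold>\<longrightarrow> \<^bold>\<exists>\<diamond>p0 \<in> MB U" by simp
qed

text \<open>General enough for both \<open>MGLB\<close> and \<open>MplusGrzB\<close>. Each scheme of
  K is a generator of \<open>logK\<close>, first read in the modality \<open>m\<close> and then
  substituted into; for \<open>Exi\<close> it is found inside \<open>S5\<close>.\<close>

lemma monadic_logic_nclosure:
  assumes U: "logK \<subseteq> U" and G: "MB U \<subseteq> nclosure G"
  shows "monadic_logic (nclosure G)"
proof -
  have "logK \<subseteq> S5" unfolding S5_def by (rule extend_upper)
  then have K: "map_fm (\<lambda>_. m) a \<in> nclosure G" if "a \<in> logK" for a m
  proof (cases m)
    case Poss
    then show ?thesis using that U G MB_upper(1)[of U] by blast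
  next
    case Exi
    then show ?thesis using that \<open>logK \<subseteq> S5\<close> G MB_upper(2)[of U] by blast
  qed
  have inst: "b \<in> nclosure G" if "a \<in> logK" "b = subst s (map_fm (\<lambda>_. m) a)" for a b s m
    using that K by (simp add: nclosure.sub)
  have S5: "map_fm (\<lambda>_. Exi) a \<in> nclosure G"
    if "a \<in> {ubox p0 \<^bold>\<longrightarrow> p0, ubox p0 \<^bold>\<longrightarrow> ubox (ubox p0), udia p0 \<^bold>\<longrightarrow> ubox (udia p0)}" for a
  proof -
    have "a \<in> S5" unfolding S5_def by (rule subsetD[OF extend_upper(2) that])
    then show ?thesis using G MB_upper(2)[of U] by blast
  qed
  show ?thesis
  proof
    show "a \<in> nclosure G" if "tautology a" for a
      by (rule inst[where m = Poss and s = from_nat, OF logK_tautology[OF tautology_skeleton[OF that]]])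
        (rule subst_skeleton[symmetric])
    show "b \<in> nclosure G" if "a \<^bold>\<longrightarrow> b \<in> nclosure G" "a \<in> nclosure G" for a b
      using that by (rule nclosure.mp)
    show "subst s a \<in> nclosure G" if "a \<in> nclosure G" for s a
      using that by (rule nclosure.sub)
    show "Box m a \<in> nclosure G" if "a \<in> nclosure G" for m a
      using that by (rule nclosure.nec)
    show "Box m (a \<^bold>\<longrightarrow> b) \<^bold>\<longrightarrow> Box m a \<^bold>\<longrightarrow> Box m b \<in> nclosure G" for m a b
      by (rule inst[of "ubox (p0 \<^bold>\<longrightarrow> q0) \<^bold>\<longrightarrow> (ubox p0 \<^bold>\<longrightarrow> ubox q0)" _ "\<lambda>n. if n = 0 then a else b" m])
        (auto simp: logK_def intro: nclosure.base)
    show "Dia m a \<^bold>\<longrightarrow> Neg (Box m (Neg a)) \<in> nclosure G" for m a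
      by (rule inst[of "udia p0 \<^bold>\<longrightarrow> Neg (ubox (Neg p0))" _ "\<lambda>n. a" m])
        (auto simp: logK_def intro: nclosure.base)
    show "Neg (Box m (Neg a)) \<^bold>\<longrightarrow> Dia m a \<in> nclosure G" for m a
      by (rule inst[of "Neg (ubox (Neg p0)) \<^bold>\<longrightarrow> udia p0" _ "\<lambda>n. a" m])
        (auto simp: logK_def intro: nclosure.base)
    show "\<^bold>\<forall>p0 \<^bold>\<longrightarrow> p0 \<in> nclosure G" "\<^bold>\<exists>p0 \<^bold>\<longrightarrow> \<^bold>\<forall>\<^bold>\<exists>p0 \<in> nclosure G"
      using S5 by force+
    show "\<^bold>\<exists>\<diamond>p0 \<^bold>\<longrightarrow> \<diamond>\<^bold>\<exists>p0 \<in> nclosure G" "\<diamond>\<^bold>\<exists>p0 \<^bold>\<longrightarrow> \<^bold>\<exists>\<diamond>p0 \<in> nclosure G"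
      using G MB_upper[of U] by auto
  qed
qed

locale glb_logic = monadic_logic +
  assumes Lob: "\<box>(\<box>p0 \<^bold>\<longrightarrow> p0) \<^bold>\<longrightarrow> \<box>p0 \<in> L"

interpretation MGLB: glb_logic MGLB
proof -
  have "logK \<subseteq> GL" unfolding GL_def by (rule extend_upper)
  then have "monadic_logic MGLB"
    unfolding MGLB_def MB_def extend_def[of _ "{\<diamond>\<^bold>\<exists>p0 \<^bold>\<longrightarrow> \<^bold>\<exists>\<diamond>p0}"]
    by (rule monadic_logic_nclosure) (simp add: MB_def extend_def)
  moreover have "ubox (ubox p0 \<^bold>\<longrightarrow> p0) \<^bold>\<longrightarrow> ubox p0 \<in> GL"
    unfolding GL_def by (rule subsetD[OF extend_upper(2)]) simp
  then have "map_fm (\<lambda>_. Poss) (ubox (ubox p0 \<^bold>\<longrightarrow> p0) \<^bold>\<longrightarrow> ubox p0) \<in> MGLB"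
    unfolding MGLB_def using MB_upper(1) by blast
  ultimately show "glb_logic MGLB"
    by (simp add: glb_logic_def glb_logic_axioms_def)
qed

text \<open>\<open>Casari\<close> is, up to equivalence, the Goedel translation of the monadic
  Casari formula \<open>\<forall>((p \<longrightarrow> \<forall>p) \<longrightarrow> \<forall>p)
  \<longrightarrow> \<forall>p\<close>.\<close>

locale grzb_logic = monadic_logic +
  assumes Grz: "\<box>(\<box>(p0 \<^bold>\<longrightarrow> \<box>p0) \<^bold>\<longrightarrow> p0) \<^bold>\<longrightarrow> p0 \<in> L"
    and Casari: "\<box>\<^bold>\<forall>(\<box>(\<box>p0 \<^bold>\<longrightarrow> \<box>\<^bold>\<forall>p0) \<^bold>\<longrightarrow> \<box>\<^bold>\<forall>p0) \<^bold>\<longrightarrow> \<box>\<^bold>\<forall>p0 \<in> L"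

interpretation MplusGrzB: grzb_logic MplusGrzB
proof -
  have "logK \<subseteq> Grz" unfolding Grz_def by (rule extend_upper)
  moreover have sup: "MB Grz \<subseteq> MplusGrzB"
    unfolding MplusGrzB_def MGrzB_def by (rule extend_upper)
  ultimately have "monadic_logic MplusGrzB"
    unfolding MplusGrzB_def extend_def by (rule monadic_logic_nclosure)
  moreover have "ubox (ubox (p0 \<^bold>\<longrightarrow> ubox p0) \<^bold>\<longrightarrow> p0) \<^bold>\<longrightarrow> p0 \<in> Grz"
    unfolding Grz_def by (rule subsetD[OF extend_upper(2)]) simp
  then have "map_fm (\<lambda>_. Poss) (ubox (ubox (p0 \<^bold>\<longrightarrow> ubox p0) \<^bold>\<longrightarrow> p0) \<^bold>\<longrightarrow> p0) \<in> MplusGrzB"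
    using sup MB_upper(1) by blast
  moreover have "\<box>\<^bold>\<forall>(\<box>(\<box>p0 \<^bold>\<longrightarrow> \<box>\<^bold>\<forall>p0) \<^bold>\<longrightarrow> \<box>\<^bold>\<forall>p0) \<^bold>\<longrightarrow> \<box>\<^bold>\<forall>p0 \<in> MplusGrzB"
    unfolding MplusGrzB_def by (rule subsetD[OF extend_upper(2)]) simp
  ultimately show "grzb_logic MplusGrzB"
    by (simp add: grzb_logic_def grzb_logic_axioms_def)
qed

section \<open>Translating into MGLB\<close>

lemma plus_trans_subst: "plus_trans (subst s a) = subst (plus_trans \<circ> s) (plus_trans a)"
proof (induction a)
  case (Dia m a)
  then show ?case by (cases m) auto
qed auto

lemma map_fm_subst: "map_fm f (subst s a) = subst (map_fm f \<circ> s) (map_fm f a)"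
  by (induction a) auto

lemma tautology_plus_trans:
  assumes "tautology a"
  shows "tautology (plus_trans a)"
proof -
  have "bval v (plus_trans a) = bval (\<lambda>b. bval v (plus_trans b)) a" for v
  proof (induction a)
    case (Dia m a)
    then show ?case by (cases m) auto
  qed auto
  with assms show ?thesis by (simp add: tautology_def)
qed

lemma tautology_map_fm:
  assumes "tautology a"
  shows "tautology (map_fm f a)"
proof -
  have "bval v (map_fm f a) = bval (\<lambda>b. v (map_fm f b)) a" for v
    by (induction a) auto
  with assms show ?thesis by (simp add: tautology_def)
qed

section \<open>Loeb's axiom in the canonical frame\<close>

context glb_logic
begin

text \<open>Loeb's axiom for the complement of \<open>P\<close>, contraposed.\<close>

lemma Lob_max:
  assumes P: "definable P" and x: "x \<rightarrow> y" "P y"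
  shows "\<exists>z. x \<rightarrow> z \<and> P z \<and> (\<forall>w. z \<rightarrow> w \<longrightarrow> \<not> P w)"
proof -
  have "csat (\<lambda>_ y. \<not> P y) x (\<box>(\<box>p0 \<^bold>\<longrightarrow> p0) \<^bold>\<longrightarrow> \<box>p0)"
    by (rule canonical_axiom[OF Lob can_mcs(1)[OF x(1)]]) (rule definable_not[OF P])
  then have "(\<forall>y. x \<rightarrow> y \<longrightarrow> (\<forall>z. y \<rightarrow> z \<longrightarrow> \<not> P z) \<longrightarrow> \<not> P y) \<longrightarrow>
      (\<forall>y. x \<rightarrow> y \<longrightarrow> \<not> P y)"
    unfolding csat by blast
  then show ?thesis using x by blast
qed

lemma R_trans:
  assumes "x \<rightarrow> y" "y \<rightarrow> z"
  shows "x \<rightarrow> z"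
proof -
  have "a \<in> z" if a: "\<box>a \<in> x" for a
  proof (rule ccontr)
    assume "a \<notin> z"
    \<comment> \<open>The instance by which Loeb's axiom yields axiom 4: above a last point where
      \<open>a\<close> and \<open>\<box>a\<close> fail jointly, \<open>a\<close> holds everywhere,
      so \<open>\<box>a\<close> holds at that point, and \<open>a\<close> holds there because of
      \<open>x\<close>.\<close>
    let ?P = "\<lambda>y. \<not> (a \<in> y \<and> \<box>a \<in> y)"
    have "?P y" using \<open>a \<notin> z\<close> assms(2) unfolding can_def by blast
    have "definable ?P"
      by (intro definable_not definable_conj definable_mem)
    then have "\<exists>w. x \<rightarrow> w \<and> ?P w \<and> (\<forall>v. w \<rightarrow> v \<longrightarrow> \<not> ?P v)"
      using assms(1) \<open>?P y\<close> by (rule Lob_max[of ?P])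
    then obtain w where w: "x \<rightarrow> w" "?P w" and last: "\<And>v. w \<rightarrow> v \<Longrightarrow> \<not> ?P v"
      by metis
    have "a \<in> v" if "w \<rightarrow> v" for v using last[OF that] by blast
    then have "\<box>a \<in> w" using mcs_Box[OF can_mcs(2)[OF w(1)]] by blast
    moreover have "a \<in> w" using w(1) a unfolding can_def by blast
    ultimately show False using w by blast
  qed
  then show ?thesis using assms unfolding can_def by blast
qed

text \<open>The relation that interprets the translated diamond.\<close>

definition R_eq (infix \<open>\<rightarrow>\<^sub>=\<close> 50) where "x \<rightarrow>\<^sub>= y \<longleftrightarrow> x = y \<or> x \<rightarrow> y"

lemma csat_plus:
  "csat V x (plus_trans (Var n)) \<longleftrightarrow> V n x"
  "csat V x (plus_trans Bot) \<longleftrightarrow> False"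
  "csat V x (plus_trans (a \<^bold>\<longrightarrow> b)) \<longleftrightarrow> csat V x (plus_trans a) \<longrightarrow> csat V x (plus_trans b)"
  "csat V x (plus_trans (\<diamond>a)) \<longleftrightarrow> (\<exists>y. x \<rightarrow>\<^sub>= y \<and> csat V y (plus_trans a))"
  "csat V x (plus_trans (\<^bold>\<exists>a)) \<longleftrightarrow> (\<exists>y. x \<sim> y \<and> csat V y (plus_trans a))"
  unfolding plus_trans.simps csat R_eq_def by blast+

text \<open>The shape in which unfolding \<open>csat_plus\<close> leaves a translated box.\<close>

lemma Box_unfold: "((\<exists>y. P y \<and> (Q y \<longrightarrow> False)) \<longrightarrow> False) \<longleftrightarrow> (\<forall>y. P y \<longrightarrow> Q y)"
  by blast

text \<open>Let \<open>y\<close> be a last point without \<open>p0\<close>. The inner implication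
  holds at \<open>y\<close> vacuously and above \<open>y\<close> because \<open>p0\<close> is
  permanent there, so the antecedent forces \<open>p0\<close> at \<open>y\<close>.\<close>

lemma Grz_plus: "plus_trans (\<box>(\<box>(p0 \<^bold>\<longrightarrow> \<box>p0) \<^bold>\<longrightarrow> p0) \<^bold>\<longrightarrow> p0) \<in> L"
proof -
  have main: "p0 \<in> x" if A: "\<forall>y. x \<rightarrow>\<^sub>= y \<longrightarrow>
    (\<forall>z. y \<rightarrow>\<^sub>= z \<longrightarrow> p0 \<in> z \<longrightarrow> (\<forall>w. z \<rightarrow>\<^sub>= w \<longrightarrow> p0 \<in> w)) \<longrightarrow> p0 \<in> y" for x
  proof (rule ccontr)
    assume "p0 \<notin> x"
    have "\<exists>y. x \<rightarrow>\<^sub>= y \<and> p0 \<notin> y \<and> (\<forall>w. y \<rightarrow> w \<longrightarrow> p0 \<in> w)"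
    proof (cases "\<exists>y. x \<rightarrow> y \<and> p0 \<notin> y")
      case True
      then obtain y where "x \<rightarrow> y" "p0 \<notin> y" by blast
      with definable_not[OF definable_mem] have "\<exists>z. x \<rightarrow> z \<and> p0 \<notin> z \<and> (\<forall>w. z \<rightarrow> w \<longrightarrow> \<not> p0 \<notin> w)"
        by (rule Lob_max[of "\<lambda>y. p0 \<notin> y"])
      then show ?thesis unfolding R_eq_def by blast
    qed (use \<open>p0 \<notin> x\<close> R_eq_def in blast)
    then obtain y where "x \<rightarrow>\<^sub>= y" "p0 \<notin> y" "\<And>w. y \<rightarrow> w \<Longrightarrow> p0 \<in> w" by blast
    then show False using A R_trans unfolding R_eq_def by metis
  qed
  show ?thesis
    unfolding mem_L_iff_csat csat_plus Box_unfold by (intro allI impI, rule main, assumption+)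
qed

lemma Casari_plus:
  "plus_trans (\<box>\<^bold>\<forall>(\<box>(\<box>p0 \<^bold>\<longrightarrow> \<box>\<^bold>\<forall>p0) \<^bold>\<longrightarrow> \<box>\<^bold>\<forall>p0) \<^bold>\<longrightarrow> \<box>\<^bold>\<forall>p0) \<in> L"
proof -
  have main: "p0 \<in> x''" if A: "\<forall>y. x \<rightarrow>\<^sub>= y \<longrightarrow> (\<forall>y'. y \<sim> y' \<longrightarrow>
      (\<forall>z. y' \<rightarrow>\<^sub>= z \<longrightarrow> (\<forall>w. z \<rightarrow>\<^sub>= w \<longrightarrow> p0 \<in> w) \<longrightarrow>
        (\<forall>w. z \<rightarrow>\<^sub>= w \<longrightarrow> (\<forall>w'. w \<sim> w' \<longrightarrow> p0 \<in> w'))) \<longrightarrow>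
      (\<forall>z. y' \<rightarrow>\<^sub>= z \<longrightarrow> (\<forall>z'. z \<sim> z' \<longrightarrow> p0 \<in> z')))"
    and x': "x \<rightarrow>\<^sub>= x'" "x' \<sim> x''" for x x' x''
  proof (rule ccontr)
    assume "p0 \<notin> x''"
    \<comment> \<open>A property of the whole cluster: a last point for it lies in a last cluster
      where \<open>p0\<close> fails somewhere.\<close>
    let ?P = "\<lambda>y. \<exists>z. y \<sim> z \<and> p0 \<notin> z"
    have P: "definable ?P"
      by (intro definable_Dia definable_not definable_mem)
    have "\<exists>y. x \<rightarrow>\<^sub>= y \<and> ?P y \<and> (\<forall>w. y \<rightarrow> w \<longrightarrow> \<not> ?P w)"
    proof (cases "\<exists>y. x \<rightarrow> y \<and> ?P y")
      case True
      then obtain y where "x \<rightarrow> y" "?P y" by blast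
      with P have "\<exists>z. x \<rightarrow> z \<and> ?P z \<and> (\<forall>w. z \<rightarrow> w \<longrightarrow> \<not> ?P w)"
        by (rule Lob_max[of ?P])
      then show ?thesis unfolding R_eq_def by blast
    next
      case False
      then show ?thesis using x' \<open>p0 \<notin> x''\<close> unfolding R_eq_def by blast
    qed
    then obtain y y' where y: "x \<rightarrow>\<^sub>= y" "y \<sim> y'" "p0 \<notin> y'"
      and last: "\<And>w. y \<rightarrow> w \<Longrightarrow> \<not> ?P w" by blast
    \<comment> \<open>Every cluster strictly above \<open>y'\<close> is also strictly above
      \<open>y\<close>, by \<open>E_R\<close>.\<close>
    have last': "p0 \<in> v" if w: "y' \<rightarrow> w" "w \<sim> v" for w v
    proof -
      obtain u where "y \<rightarrow> u" "u \<sim> w" using E_R[OF y(2) w(1)] .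
      then show ?thesis using last E_trans w(2) by blast
    qed
    \<comment> \<open>The inner antecedent of the axiom at \<open>y'\<close>: as \<open>p0\<close>
      fails at \<open>y'\<close>, the point \<open>z\<close> is strictly above it, where all
      clusters satisfy \<open>p0\<close>.\<close>
    have "p0 \<in> w'" if "y' \<rightarrow>\<^sub>= z" "\<forall>w. z \<rightarrow>\<^sub>= w \<longrightarrow> p0 \<in> w" "z \<rightarrow>\<^sub>= w" "w \<sim> w'" for z w w'
      using that y(3) last' R_trans unfolding R_eq_def by metis
    moreover have "y' \<rightarrow>\<^sub>= y'" "y' \<sim> y'"
      using E_refl[OF can_mcs(2)[OF y(2)]] by (simp_all add: R_eq_def)
    ultimately show False using A y by blast
  qed
  show ?thesis
    unfolding mem_L_iff_csat csat_plus Box_unfold by (intro allI impI, rule main, assumption+)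
qed

end

text \<open>The renaming \<open>f\<close> lets one induction serve the unimodal logics in either
  modality, with \<open>f\<close> constant, and the bimodal ones, with \<open>f\<close> the
  identity.\<close>

lemma plus_trans_nclosure:
  assumes "a \<in> nclosure G" and "\<And>b. b \<in> G \<Longrightarrow> plus_trans (map_fm f b) \<in> MGLB"
  shows "plus_trans (map_fm f a) \<in> MGLB"
  using assms(1)
proof induction
  case (sub a s)
  then show ?case by (simp add: map_fm_subst plus_trans_subst MGLB.sub)
next
  case (nec a m)
  then have "MGLB.mcs x \<Longrightarrow> MGLB.csat (\<lambda>n y. Var n \<in> y) x (plus_trans (map_fm f a))" for x
    using MGLB.mem_L_iff_csat by blast
  then show ?case
    by (cases "f m")
      (auto simp: MGLB.mem_L_iff_csat MGLB.csat simp del: sat.simps(4) dest: MGLB.can_mcs)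
qed (auto simp: assms(2) intro: MGLB.mp)

lemma plus_trans_extend:
  assumes "a \<in> L \<^bold>+ A"
    and "\<And>b. b \<in> L \<Longrightarrow> plus_trans (map_fm f b) \<in> MGLB"
    and "\<And>b. b \<in> A \<Longrightarrow> plus_trans (map_fm f b) \<in> MGLB"
  shows "plus_trans (map_fm f a) \<in> MGLB"
  using assms(1) unfolding extend_def
  by (rule plus_trans_nclosure) (use assms(2,3) in blast)

lemma plus_trans_logK:
  assumes "a \<in> logK"
  shows "plus_trans (map_fm f a) \<in> MGLB"
  using assms unfolding logK_def
proof (rule plus_trans_nclosure)
  fix b
  assume "b \<in> {a. tautology a} \<union>
     {ubox (p0 \<^bold>\<longrightarrow> q0) \<^bold>\<longrightarrow> (ubox p0 \<^bold>\<longrightarrow> ubox q0),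
      udia p0 \<^bold>\<longrightarrow> Neg (ubox (Neg p0)),
      Neg (ubox (Neg p0)) \<^bold>\<longrightarrow> udia p0}"
  then consider "tautology b" | "b = ubox (p0 \<^bold>\<longrightarrow> q0) \<^bold>\<longrightarrow> (ubox p0 \<^bold>\<longrightarrow> ubox q0)"
    | "b = udia p0 \<^bold>\<longrightarrow> Neg (ubox (Neg p0))" | "b = Neg (ubox (Neg p0)) \<^bold>\<longrightarrow> udia p0"
    by blast
  then show "plus_trans (map_fm f b) \<in> MGLB"
  proof cases
    case 1
    then show ?thesis by (intro MGLB.taut tautology_plus_trans tautology_map_fm)
  qed (cases "f ()"; auto simp: MGLB.mem_L_iff_csat MGLB.csat simp del: sat.simps(4))+
qed

lemma plus_trans_S5:
  assumes "a \<in> S5"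
  shows "plus_trans (map_fm (\<lambda>_. Exi) a) \<in> MGLB"
  using assms unfolding S5_def
proof (rule plus_trans_extend)
  fix b assume b: "b \<in> {ubox p0 \<^bold>\<longrightarrow> p0, ubox p0 \<^bold>\<longrightarrow> ubox (ubox p0), udia p0 \<^bold>\<longrightarrow> ubox (udia p0)}"
  then have "b \<in> S5" unfolding S5_def by (rule subsetD[OF extend_upper(2)])
  then have "map_fm (\<lambda>_. Exi) b \<in> MGLB"
    unfolding MGLB_def using MB_upper(2) by blast
  \<comment> \<open>These axioms contain no \<open>\<diamond>\<close>, so the translation leaves
    them alone.\<close>
  moreover have "plus_trans (map_fm (\<lambda>_. Exi) b) = map_fm (\<lambda>_. Exi) b"
    using b by auto
  ultimately show "plus_trans (map_fm (\<lambda>_. Exi) b) \<in> MGLB" by simp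
qed (rule plus_trans_logK)

lemma plus_trans_Grz:
  assumes "a \<in> Grz"
  shows "plus_trans (map_fm (\<lambda>_. Poss) a) \<in> MGLB"
  using assms unfolding Grz_def
proof (rule plus_trans_extend)
  fix b assume "b \<in> {ubox (ubox (p0 \<^bold>\<longrightarrow> ubox p0) \<^bold>\<longrightarrow> p0) \<^bold>\<longrightarrow> p0}"
  then show "plus_trans (map_fm (\<lambda>_. Poss) b) \<in> MGLB"
    using MGLB.Grz_plus by simp
qed (rule plus_trans_logK)

lemma plus_trans_MplusGrzB:
  assumes "a \<in> MplusGrzB"
  shows "plus_trans a \<in> MGLB"
proof -
  have "plus_trans (map_fm (\<lambda>m. m) a) \<in> MGLB"
    using assms unfolding MplusGrzB_def MGrzB_def MB_def fusion_S5_def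
  proof (elim plus_trans_extend plus_trans_nclosure)
    fix b assume "b \<in> map_fm (\<lambda>_. Poss) ` Grz \<union> map_fm (\<lambda>_. Exi) ` S5"
    then show "plus_trans (map_fm (\<lambda>m. m) b) \<in> MGLB"
      using plus_trans_Grz plus_trans_S5 by (auto simp: fm.map_ident)
  next
    fix b assume "b \<in> {\<^bold>\<exists>\<diamond>p0 \<^bold>\<longrightarrow> \<diamond>\<^bold>\<exists>p0}"
    then have b: "b = \<^bold>\<exists>\<diamond>p0 \<^bold>\<longrightarrow> \<diamond>\<^bold>\<exists>p0" by simp
    have "MGLB.mcs x \<Longrightarrow> MGLB.csat V x (plus_trans b)" for V x
      unfolding b plus_trans.simps MGLB.csat by (meson MGLB.E_R)
    then show "plus_trans (map_fm (\<lambda>m. m) b) \<in> MGLB"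
      by (simp add: fm.map_ident MGLB.mem_L_iff_csat)
  next
    fix b assume "b \<in> {\<diamond>\<^bold>\<exists>p0 \<^bold>\<longrightarrow> \<^bold>\<exists>\<diamond>p0}"
    then have b: "b = \<diamond>\<^bold>\<exists>p0 \<^bold>\<longrightarrow> \<^bold>\<exists>\<diamond>p0" by simp
    have "MGLB.mcs x \<Longrightarrow> MGLB.csat V x (plus_trans b)" for V x
      unfolding b plus_trans.simps MGLB.csat by (meson MGLB.R_E)
    then show "plus_trans (map_fm (\<lambda>m. m) b) \<in> MGLB"
      by (simp add: fm.map_ident MGLB.mem_L_iff_csat)
  next
    fix b
    assume "b \<in> {\<box>\<^bold>\<forall>(\<box>(\<box>p0 \<^bold>\<longrightarrow> \<box>\<^bold>\<forall>p0) \<^bold>\<longrightarrow> \<box>\<^bold>\<forall>p0) \<^bold>\<longrightarrow> \<box>\<^bold>\<forall>p0}"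
    then show "plus_trans (map_fm (\<lambda>m. m) b) \<in> MGLB"
      using MGLB.Casari_plus by (simp add: fm.map_ident)
  qed
  then show ?thesis by (simp add: fm.map_ident)
qed

section \<open>Types and cluster types\<close>

context grzb_logic
begin

lemma Grz_semantic:
  assumes P: "definable P" and x: "mcs x"
    and "\<And>y. x \<rightarrow> y \<Longrightarrow> (\<And>z w. y \<rightarrow> z \<Longrightarrow> P z \<Longrightarrow> z \<rightarrow> w \<Longrightarrow> P w) \<Longrightarrow> P y"
  shows "P x"
proof -
  have "csat (\<lambda>_. P) x (\<box>(\<box>(p0 \<^bold>\<longrightarrow> \<box>p0) \<^bold>\<longrightarrow> p0) \<^bold>\<longrightarrow> p0)"
    by (rule canonical_axiom[OF Grz x P])
  moreover have "csat (\<lambda>_. P) x (\<box>(\<box>(p0 \<^bold>\<longrightarrow> \<box>p0) \<^bold>\<longrightarrow> p0))"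
    unfolding csat using assms(3) by blast
  ultimately show ?thesis unfolding csat by blast
qed

text \<open>If \<open>\<box>a\<close> is in \<open>x\<close>, all successors contain
  \<open>a\<close>, so the antecedent of Grz for \<open>a\<close> holds at \<open>x\<close>.\<close>

lemma R_refl:
  assumes x: "mcs x"
  shows "x \<rightarrow> x"
proof -
  have "a \<in> x" if "\<box>a \<in> x" for a
    using definable_mem x by (rule Grz_semantic) (use that in \<open>auto simp only: can_def\<close>)
  then show ?thesis using x unfolding can_def by blast
qed

lemma R_trans:
  assumes "x \<rightarrow> y" "y \<rightarrow> z"
  shows "x \<rightarrow> z"
proof -
  have x: "mcs x" using assms can_mcs by blast
  have "a \<in> z" if a: "\<box>a \<in> x" for a
  proof -
    \<comment> \<open>the instance of the Grz axiom that classically yields the 4 axiom\<close>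
    let ?P = "\<lambda>y. a \<in> y \<and> (\<box>a \<in> y \<longrightarrow> \<box>\<box>a \<in> y)"
    have "?P x"
    proof (rule Grz_semantic[OF _ x])
      show "definable ?P" by (intro definable_conj definable_imp definable_mem)
      fix y assume y: "x \<rightarrow> y" and step: "\<And>z w. y \<rightarrow> z \<Longrightarrow> ?P z \<Longrightarrow> z \<rightarrow> w \<Longrightarrow> ?P w"
      have "a \<in> y" using a y unfolding can_def by blast
      moreover have "\<box>\<box>a \<in> y" if "\<box>a \<in> y"
      proof -
        \<comment> \<open>A point with \<open>a\<close> but without \<open>\<box>a\<close> satisfies
          \<open>?P\<close> vacuously; \<open>step\<close> then gives \<open>a\<close> at all its
          successors, which is \<open>\<box>a\<close>.\<close>
        have "\<box>a \<in> z" if z: "y \<rightarrow> z" for z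
        proof (rule ccontr)
          assume "\<box>a \<notin> z"
          moreover have "a \<in> z" using z \<open>\<box>a \<in> y\<close> unfolding can_def by blast
          ultimately have "\<And>w. z \<rightarrow> w \<Longrightarrow> a \<in> w" using step[OF z] by blast
          then show False using \<open>\<box>a \<notin> z\<close> mcs_Box[OF can_mcs(2)[OF z]] by blast
        qed
        then show ?thesis using mcs_Box[OF can_mcs(2)[OF y]] by blast
      qed
      ultimately show "?P y" by blast
    qed
    then have "\<box>\<box>a \<in> x" using a by blast
    then show ?thesis using assms unfolding can_def by blast
  qed
  then show ?thesis using assms unfolding can_def by blast
qed

text \<open>Grz for the complement of \<open>P\<close>, contraposed. As \<open>\<rightarrow>\<close>
  is reflexive, no strictly last point can be asked for; \<open>P\<close> may persist above
  \<open>z\<close>, but once lost it stays lost.\<close>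

lemma Grz_max:
  assumes P: "definable P" and x: "mcs x" "P x"
  shows "\<exists>z. x \<rightarrow> z \<and> P z \<and> (\<forall>w v. z \<rightarrow> w \<longrightarrow> \<not> P w \<longrightarrow> w \<rightarrow> v \<longrightarrow> \<not> P v)"
  using Grz_semantic[of "\<lambda>y. \<not> P y", OF definable_not[OF P] x(1)] x(2) by blast

text \<open>The order of clusters, lifted to points: \<open>\<box>\<forall>\<close> is the box of
  this relation.\<close>

definition le (infix \<open>\<preceq>\<close> 50) where "x \<preceq> z \<longleftrightarrow> (\<exists>y. x \<rightarrow> y \<and> y \<sim> z)"

lemma le_refl: "mcs x \<Longrightarrow> x \<preceq> x"
  unfolding le_def using R_refl E_refl by blast

lemma le_trans:
  assumes "x \<preceq> y" "y \<preceq> z"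
  shows "x \<preceq> z"
proof -
  obtain a b where a: "x \<rightarrow> a" "a \<sim> y" and b: "y \<rightarrow> b" "b \<sim> z"
    using assms unfolding le_def by blast
  obtain c where "a \<rightarrow> c" "c \<sim> b" using a(2) b(1) by (rule E_R)
  then show ?thesis unfolding le_def using R_trans[OF a(1)] E_trans[OF _ b(2)] by blast
qed

lemma R_le: "x \<rightarrow> y \<Longrightarrow> x \<preceq> y"
  unfolding le_def using E_refl can_mcs by blast

lemma E_le: "x \<sim> y \<Longrightarrow> x \<preceq> y"
  unfolding le_def using R_refl can_mcs by blast

lemma le_mcs: "x \<preceq> y \<Longrightarrow> mcs x" "x \<preceq> y \<Longrightarrow> mcs y"
  unfolding le_def using can_mcs by blast+

text \<open>Strengthens \<open>Grz_max\<close>: a loss of \<open>P\<close> at one point above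
  \<open>z\<close> is a loss for its whole cluster and all clusters above. Grz makes the loss
  permanent along \<open>\<rightarrow>\<close>, and Casari spreads it to clusters.\<close>

lemma Casari_max:
  assumes P: "definable P" and x: "x \<preceq> x'" "P x'"
  shows "\<exists>z. x \<preceq> z \<and> P z \<and> (\<forall>w v. z \<rightarrow> w \<longrightarrow> \<not> P w \<longrightarrow> w \<preceq> v \<longrightarrow> \<not> P v)"
proof -
  let ?Q = "\<lambda>_ y. \<not> P y"
  let ?A = "\<box>(\<box>p0 \<^bold>\<longrightarrow> \<box>\<^bold>\<forall>p0)" and ?B = "\<box>\<^bold>\<forall>p0"
  have Ball: "csat ?Q u (\<box>\<^bold>\<forall>a) \<longleftrightarrow> (\<forall>v. u \<preceq> v \<longrightarrow> csat ?Q v a)" for u a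
    unfolding le_def csat_Box by blast
  have Box: "csat ?Q u ?A \<longleftrightarrow> (\<forall>v. u \<rightarrow> v \<longrightarrow> csat ?Q v (\<box>p0 \<^bold>\<longrightarrow> ?B))"
    "csat ?Q u (\<box>p0) \<longleftrightarrow> (\<forall>v. u \<rightarrow> v \<longrightarrow> \<not> P v)" for u
    unfolding csat_Box[of _ _ _ "\<box>p0 \<^bold>\<longrightarrow> ?B"] csat_Box[of _ _ _ p0] by simp_all
  have Imp: "csat ?Q u (?A \<^bold>\<longrightarrow> ?B) \<longleftrightarrow> (csat ?Q u ?A \<longrightarrow> csat ?Q u ?B)"
    "csat ?Q u (\<box>p0 \<^bold>\<longrightarrow> ?B) \<longleftrightarrow> (csat ?Q u (\<box>p0) \<longrightarrow> csat ?Q u ?B)" for u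
    by (rule sat.simps(3))+
  have "csat ?Q x (\<box>\<^bold>\<forall>(?A \<^bold>\<longrightarrow> ?B) \<^bold>\<longrightarrow> ?B)"
    by (rule canonical_axiom[OF Casari le_mcs(1)[OF x(1)]]) (rule definable_not[OF P])
  then have "csat ?Q x (\<box>\<^bold>\<forall>(?A \<^bold>\<longrightarrow> ?B)) \<longrightarrow> csat ?Q x ?B"
    unfolding sat.simps(3)[of _ _ _ _ "\<box>\<^bold>\<forall>(?A \<^bold>\<longrightarrow> ?B)"] .
  \<comment> \<open>The axiom contraposed: \<open>P\<close> occurs above \<open>x\<close>, so the
    premise under \<open>\<box>\<forall>\<close> fails at some \<open>y\<close>, where
    \<open>?A\<close> holds and \<open>?B\<close> does not.\<close>
  then obtain y where "x \<preceq> y"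
    and A: "\<And>z v. y \<rightarrow> z \<Longrightarrow> (\<forall>u. z \<rightarrow> u \<longrightarrow> \<not> P u) \<Longrightarrow> z \<preceq> v \<Longrightarrow> \<not> P v"
    and B: "\<exists>v. y \<preceq> v \<and> P v"
    unfolding Ball Box Imp sat.simps(1) using x by blast
  have y: "mcs y" using le_mcs(2)[OF \<open>x \<preceq> y\<close>] .
  \<comment> \<open>If no \<open>\<rightarrow>\<close>-successor of \<open>y\<close> had
    \<open>P\<close>, then \<open>A\<close> at \<open>y\<close> itself would contradict
    \<open>B\<close>.\<close>
  obtain u where u: "y \<rightarrow> u" "P u"
    using B A[OF R_refl[OF y]] by blast
  obtain z where z: "u \<rightarrow> z" "P z" "\<And>w v. z \<rightarrow> w \<Longrightarrow> \<not> P w \<Longrightarrow> w \<rightarrow> v \<Longrightarrow> \<not> P v"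
    using Grz_max[OF P can_mcs(2)[OF u(1)] u(2)] by blast
  have yz: "y \<rightarrow> z" using u z R_trans by blast
  show ?thesis
  proof (intro exI conjI allI impI)
    show "x \<preceq> z" using le_trans[OF \<open>x \<preceq> y\<close> R_le[OF yz]] .
    fix w v assume w: "z \<rightarrow> w" "\<not> P w" "w \<preceq> v"
    then have "\<forall>u. w \<rightarrow> u \<longrightarrow> \<not> P u" using z(3) by blast
    then show "\<not> P v" using A[OF R_trans[OF yz w(1)]] w(3) by blast
  qed (rule z(2))
qed

end

locale grzb_types = grzb_logic +
  fixes \<Sigma> :: "bfm set"
  assumes finite_\<Sigma>: "finite \<Sigma>"
    and Imp_\<Sigma>: "a \<^bold>\<longrightarrow> b \<in> \<Sigma> \<Longrightarrow> a \<in> \<Sigma> \<and> b \<in> \<Sigma>"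
    and Dia_\<Sigma>: "Dia m a \<in> \<Sigma> \<Longrightarrow> a \<in> \<Sigma>"
begin

definition tp :: "bfm set \<Rightarrow> bfm set" where "tp x = x \<inter> \<Sigma>"

definition ctp :: "bfm set \<Rightarrow> bfm set set" where "ctp x = tp ` {y. x \<sim> y}"

lemma ctp_cong:
  assumes "x \<sim> y"
  shows "ctp x = ctp y"
proof -
  have "{z. x \<sim> z} = {z. y \<sim> z}"
    using E_euclid[OF assms] E_trans[OF assms] by blast
  then show ?thesis by (simp add: ctp_def)
qed

lemma tp_in_ctp: "x \<sim> y \<Longrightarrow> tp y \<in> ctp x"
  unfolding ctp_def by blast

lemma ctpE:
  assumes "t \<in> ctp x"
  obtains y where "x \<sim> y" "tp y = t"
  using assms unfolding ctp_def by blast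

lemma tp_subset: "tp x \<in> Pow \<Sigma>"
  unfolding tp_def by blast

lemma ctp_subset: "ctp x \<in> Pow (Pow \<Sigma>)"
  unfolding ctp_def using tp_subset by blast

lemma tp_mem: "tp x = tp y \<Longrightarrow> a \<in> \<Sigma> \<Longrightarrow> a \<in> x \<longleftrightarrow> a \<in> y"
  unfolding tp_def by blast

lemma definable_const: "definable (\<lambda>x. c)"
  using definable_False definable_not[OF definable_False] by (cases c) simp_all

lemma definable_tp: "definable (\<lambda>x. tp x = tp u)"
proof -
  have "tp x = tp u \<longleftrightarrow> (\<forall>a\<in>\<Sigma>. a \<in> x \<longleftrightarrow> a \<in> u)" for x
    unfolding tp_def by blast
  then show ?thesis
    by (simp only:) (intro definable_Ball finite_\<Sigma> definable_iff definable_mem definable_const)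
qed

text \<open>It suffices to say, for each of the finitely many types, whether the cluster realizes
  it, and that is a formula beginning with \<open>\<exists>\<close>.\<close>

lemma definable_ctp: "definable (\<lambda>x. ctp x = ctp u)"
proof -
  have mem: "t \<in> ctp x \<longleftrightarrow> (\<exists>y. x \<sim> y \<and> tp y = t)" for t x
    unfolding ctp_def by blast
  have "ctp x \<subseteq> range tp" for x
    unfolding ctp_def by blast
  then have "ctp x = ctp u \<longleftrightarrow> (\<forall>t\<in>range tp. t \<in> ctp x \<longleftrightarrow> t \<in> ctp u)" for x
    by blast
  moreover have "finite (range tp)"
    by (rule finite_subset[of _ "Pow \<Sigma>"]) (use tp_subset finite_\<Sigma> in auto)
  moreover have "definable (\<lambda>x. t \<in> ctp x \<longleftrightarrow> t \<in> ctp u)" if t: "t \<in> range tp" for t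
  proof (rule definable_iff[OF _ definable_const])
    obtain v where "t = tp v" using t by blast
    then show "definable (\<lambda>x. t \<in> ctp x)"
      using definable_Dia[OF definable_tp[of v], of Exi] by (simp add: mem)
  qed
  ultimately show ?thesis
    using definable_Ball[of "range tp" "\<lambda>t x. t \<in> ctp x \<longleftrightarrow> t \<in> ctp u"] by simp
qed

section \<open>Good points and full clusters\<close>

definition good :: "bfm set \<Rightarrow> bool" where
  "good u \<longleftrightarrow>
    (\<forall>w. u \<rightarrow> w \<longrightarrow> tp w = tp u \<and> ctp w = ctp u \<or> (\<forall>v. w \<preceq> v \<longrightarrow> ctp v \<noteq> ctp u))"

definition full :: "bfm set \<Rightarrow> bool" where
  "full x \<longleftrightarrow> mcs x \<and> (\<forall>t\<in>ctp x. \<exists>u. x \<sim> u \<and> tp u = t \<and> good u)"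

lemma good_R:
  assumes "good u" "u \<rightarrow> w" "ctp w = ctp u"
  shows "good w" "tp w = tp u"
proof -
  \<comment> \<open>By reflexivity this excludes the second alternative in
    \<open>good\<close>.\<close>
  have "\<exists>v. w \<preceq> v \<and> ctp v = ctp u" using le_refl can_mcs(2)[OF assms(2)] assms(3) by blast
  then show tp: "tp w = tp u" using assms(1,2) unfolding good_def by blast
  show "good w"
    using assms R_trans unfolding good_def tp assms(3) by blast
qed

lemma ex_good:
  assumes x: "mcs x" and t: "t \<in> ctp x"
  obtains z where "x \<preceq> z" "ctp z = ctp x" "tp z = t" "good z"
proof -
  obtain y where y: "x \<sim> y" "tp y = t" using t by (rule ctpE)
  let ?P = "\<lambda>v. tp v = tp y \<and> ctp v = ctp x"
  have P: "definable ?P" by (intro definable_conj definable_tp definable_ctp)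
  have "?P y" using ctp_cong[OF y(1)] by simp
  then have "\<exists>z. x \<preceq> z \<and> ?P z \<and> (\<forall>w v. z \<rightarrow> w \<longrightarrow> \<not> ?P w \<longrightarrow> w \<preceq> v \<longrightarrow> \<not> ?P v)"
    by (rule Casari_max[of ?P, OF P E_le[OF y(1)]])
  then obtain z where z: "x \<preceq> z" "?P z"
    and last: "\<And>w v. z \<rightarrow> w \<Longrightarrow> \<not> ?P w \<Longrightarrow> w \<preceq> v \<Longrightarrow> \<not> ?P v" by metis
  \<comment> \<open>Permanent loss of \<open>?P\<close> becomes permanent loss of the cluster type:
    any cluster with the cluster type of \<open>x\<close> realizes \<open>t\<close>, hence contains
    a point satisfying \<open>?P\<close>.\<close>
  have "ctp v \<noteq> ctp x" if w: "z \<rightarrow> w" "\<not> ?P w" "w \<preceq> v" for w v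
  proof
    assume v: "ctp v = ctp x"
    then obtain v' where "v \<sim> v'" "tp v' = t" using t ctpE by metis
    then have "w \<preceq> v'" "?P v'" using w(3) le_trans E_le v ctp_cong y(2) by metis+
    then show False using last[OF w(1,2)] by blast
  qed
  then have "good z" unfolding good_def using z(2) by metis
  then show ?thesis using that z y by blast
qed

text \<open>
  Good points are collected one type at a time: goodness is inherited along \<open>\<rightarrow>\<close> as long as the
  cluster type stays the same.
\<close>

lemma ex_full:
  assumes x: "mcs x"
  obtains d where "x \<preceq> d" "ctp d = ctp x" "full d"
proof -
  have fin: "finite (ctp x)"
    using ctp_subset finite_\<Sigma> by (metis PowD finite_Pow_iff finite_subset)
  have "\<exists>d. x \<preceq> d \<and> ctp d = ctp x \<and> (\<forall>t\<in>T. \<exists>u. d \<sim> u \<and> tp u = t \<and> good u)"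
    if "finite T" "T \<subseteq> ctp x" for T
    using that
  proof (induction T)
    case empty
    show ?case using le_refl[OF x] by blast
  next
    case (insert t T)
    then obtain d where d: "x \<preceq> d" "ctp d = ctp x"
      and T: "\<And>t. t \<in> T \<Longrightarrow> \<exists>u. d \<sim> u \<and> tp u = t \<and> good u" by auto
    obtain z where z: "d \<preceq> z" "ctp z = ctp d" "tp z = t" "good z"
      using ex_good[OF le_mcs(2)[OF d(1)], of t] insert.prems d(2) by auto
    \<comment> \<open>Moving up to the cluster of \<open>z\<close> keeps what was collected: a good
      \<open>u\<close> beside \<open>d\<close> has a successor beside \<open>z\<close>, with the
      same cluster type, hence good and of the same type.\<close>
    have "\<exists>u. z \<sim> u \<and> tp u = s \<and> good u" if "s \<in> T" for s
    proof -
      obtain u where u: "d \<sim> u" "tp u = s" "good u" using T \<open>s \<in> T\<close> by blast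
      have "u \<preceq> z" using le_trans[OF E_le[OF E_sym[OF u(1)]] z(1)] .
      then obtain w where w: "u \<rightarrow> w" "w \<sim> z" unfolding le_def by blast
      then have "ctp w = ctp u" using ctp_cong u(1) z(2) by metis
      then show ?thesis using good_R[OF u(3) w(1)] E_sym[OF w(2)] u(2) by metis
    qed
    moreover have "z \<sim> z" using E_refl le_mcs(2)[OF z(1)] by blast
    ultimately have "\<forall>s\<in>insert t T. \<exists>u. z \<sim> u \<and> tp u = s \<and> good u" using z by blast
    then show ?case using le_trans[OF d(1) z(1)] z(2) d(2) by metis
  qed
  from this[OF fin subset_refl] show ?thesis
    using that le_mcs(2) unfolding full_def by metis
qed

lemma full_E:
  assumes "full x" "x \<sim> y"
  shows "full y"
  using assms(1) E_euclid[OF assms(2)] can_mcs(2)[OF assms(2)]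
  unfolding full_def ctp_cong[OF assms(2)] by blast

text \<open>As \<open>\<preceq>\<close> only compares clusters, the last conjunct imposes what
  \<open>\<rightarrow>\<close> would give for the diamonds in \<open>\<Sigma>\<close>. Each conjunct
  depends on a point only through its cluster and type, so points may be exchanged for others that
  agree in both.\<close>

definition prec (infix \<open>\<prec>\<close> 50) where
  "x \<prec> y \<longleftrightarrow> x \<preceq> y \<and> (\<forall>z. y \<preceq> z \<longrightarrow> ctp z \<noteq> ctp x) \<and>
    (\<forall>a. \<diamond>a \<in> \<Sigma> \<longrightarrow> \<diamond>a \<in> y \<longrightarrow> \<diamond>a \<in> x)"

lemma prec_trans: "x \<prec> y \<Longrightarrow> y \<prec> z \<Longrightarrow> x \<prec> z"
  unfolding prec_def using le_trans by blast

text \<open>The finite set of cluster types occurring above a point shrinks strictly along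
  \<open>\<prec>\<close>, since that of the lower point is lost.\<close>

lemma prec_wf: "wf {(y, x). x \<prec> y}"
proof -
  let ?T = "\<lambda>x. ctp ` {z. x \<preceq> z}"
  have "?T y \<subset> ?T x" if "x \<prec> y" for x y
  proof
    show "?T y \<subseteq> ?T x" using that le_trans unfolding prec_def by blast
    have "ctp x \<in> ?T x" using that le_refl le_mcs unfolding prec_def by blast
    moreover have "ctp x \<notin> ?T y" using that unfolding prec_def by fastforce
    ultimately show "?T y \<noteq> ?T x" by blast
  qed
  moreover have "finite (?T x)" for x
    by (rule finite_subset[of _ "Pow (Pow \<Sigma>)"]) (use ctp_subset finite_\<Sigma> in auto)
  ultimately have "card (?T y) < card (?T x)" if "x \<prec> y" for x y
    using that psubset_card_mono by metis
  then have "{(y, x). x \<prec> y} \<subseteq> measure (\<lambda>x. card (?T x))"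
    by auto
  then show ?thesis using wf_measure wf_subset by blast
qed

lemma Dia_R:
  assumes "x \<rightarrow> y" "\<diamond>a \<in> y"
  shows "\<diamond>a \<in> x"
  using assms(2) R_trans[OF assms(1)]
  unfolding mcs_Dia[OF can_mcs(1)[OF assms(1)]] mcs_Dia[OF can_mcs(2)[OF assms(1)]] by blast

text \<open>Since \<open>w\<close> is chosen along \<open>\<rightarrow>\<close> from
  \<open>x\<close>, \<open>Dia_R\<close> gives the condition on diamonds; the other conjuncts only
  concern clusters. \<open>prec_E\<close> is dual.\<close>

lemma E_prec:
  assumes "x \<sim> y" "y \<prec> z"
  obtains w where "x \<prec> w" "w \<sim> z"
proof -
  have "x \<preceq> z" using assms le_trans E_le unfolding prec_def by blast
  then obtain w where w: "x \<rightarrow> w" "w \<sim> z" unfolding le_def by blast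
  have "ctp v \<noteq> ctp x" if "w \<preceq> v" for v
    using assms that le_trans[OF E_le[OF E_sym[OF w(2)]]] ctp_cong[OF assms(1)]
    unfolding prec_def by metis
  then have "x \<prec> w" unfolding prec_def using R_le[OF w(1)] Dia_R[OF w(1)] by blast
  then show ?thesis using that w(2) by blast
qed

lemma prec_E:
  assumes "x \<prec> y" "y \<sim> z"
  obtains w where "x \<sim> w" "w \<prec> z"
proof -
  have "x \<preceq> z" using assms le_trans E_le unfolding prec_def by blast
  then obtain v where v: "x \<rightarrow> v" "v \<sim> z" unfolding le_def by blast
  obtain w where w: "x \<sim> w" "w \<rightarrow> z" using R_E[OF v] .
  have "ctp u \<noteq> ctp w" if "z \<preceq> u" for u
    using assms that le_trans[OF E_le[OF assms(2)]] ctp_cong[OF w(1)]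
    unfolding prec_def by metis
  then have "w \<prec> z" unfolding prec_def using R_le[OF w(2)] Dia_R[OF w(2)] by blast
  then show ?thesis using that w(1) by blast
qed

text \<open>Fullness turns a diamond witness into a strict one; the case of \<open>a\<close> in
  \<open>x\<close> is left to the reflexive disjunct of the translation.\<close>

lemma ex_prec:
  assumes x: "full x" and a: "\<diamond>a \<in> \<Sigma>" "\<diamond>a \<in> x" "a \<notin> x"
  obtains y where "x \<prec> y" "full y" "a \<in> y"
proof -
  have mx: "mcs x" using x unfolding full_def by blast
  have aS: "a \<in> \<Sigma>" using Dia_\<Sigma>[OF a(1)] .
  \<comment> \<open>A good stand-in for \<open>x\<close>, of the same type and in the same
    cluster.\<close>
  obtain u where u: "x \<sim> u" "tp u = tp x" "good u"
    using x tp_in_ctp[OF E_refl[OF mx]] unfolding full_def by blast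
  have "\<diamond>a \<in> u" "a \<notin> u" using tp_mem[OF u(2)] a aS by blast+
  then obtain v where v: "u \<rightarrow> v" "a \<in> v" using mcs_Dia can_mcs(2)[OF u(1)] by blast
  \<comment> \<open>The formula \<open>a\<close> separates \<open>v\<close> from \<open>u\<close>,
    so going to \<open>v\<close> changes the type of a good point and the cluster type of
    \<open>u\<close> is lost above \<open>v\<close>.\<close>
  have "tp v \<noteq> tp u" using tp_mem aS v(2) \<open>a \<notin> u\<close> by blast
  then have gone: "\<And>w. v \<preceq> w \<Longrightarrow> ctp w \<noteq> ctp u" using u(3) v(1) unfolding good_def by blast
  \<comment> \<open>The cluster of \<open>v\<close> may fail to be full, so a full one above it with
    the same cluster type takes its place, and \<open>y\<close> is its point with the type of
    \<open>v\<close>.\<close>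
  obtain d where d: "v \<preceq> d" "ctp d = ctp v" "full d" using ex_full[OF can_mcs(2)[OF v(1)]] .
  obtain y where y: "d \<sim> y" "tp y = tp v"
    using tp_in_ctp[OF E_refl[OF can_mcs(2)[OF v(1)]]] d(2) ctpE by metis
  have vy: "v \<preceq> y" using le_trans[OF d(1) E_le[OF y(1)]] .
  show ?thesis
  proof
    show "full y" using full_E[OF d(3) y(1)] .
    show "a \<in> y" using tp_mem[OF y(2) aS] v(2) by blast
    show "x \<prec> y"
      unfolding prec_def
    proof (intro conjI allI impI)
      show "x \<preceq> y" using le_trans[OF E_le[OF u(1)] le_trans[OF R_le[OF v(1)] vy]] .
      show "ctp z \<noteq> ctp x" if "y \<preceq> z" for z
        using gone[OF le_trans[OF vy that]] ctp_cong[OF u(1)] by metis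
      show "\<diamond>b \<in> x" if "\<diamond>b \<in> \<Sigma>" "\<diamond>b \<in> y" for b
        using that tp_mem[OF y(2)] tp_mem[OF u(2)] Dia_R[OF v(1)] by blast
    qed
  qed
qed

section \<open>The frame of full points and its truth lemma\<close>

definition frame :: "modality \<Rightarrow> bfm set \<Rightarrow> bfm set \<Rightarrow> bool" where
  "frame m = (case m of Poss \<Rightarrow> (\<prec>) | Exi \<Rightarrow> (\<sim>))"

lemma frame_simps [simp]: "frame Poss = (\<prec>)" "frame Exi = (\<sim>)"
  by (simp_all add: frame_def)

lemma plus_trans_truth:
  assumes "a \<in> \<Sigma>" "full x"
  shows "sat {x. full x} frame (\<lambda>n y. Var n \<in> y) x (plus_trans a) \<longleftrightarrow> a \<in> x"
  using assms
proof (induction a arbitrary: x)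
  case (Imp a b)
  then have "mcs x" unfolding full_def by blast
  then show ?case using Imp Imp_\<Sigma>[OF Imp.prems(1)] by simp
next
  case (Dia m a)
  have x: "mcs x" using Dia.prems unfolding full_def by blast
  have IH: "sat {x. full x} frame (\<lambda>n y. Var n \<in> y) y (plus_trans a) \<longleftrightarrow> a \<in> y" if "full y" for y
    using Dia.IH Dia_\<Sigma>[OF Dia.prems(1)] that by blast
  show ?case
  proof (cases m)
    case Poss
    have "\<diamond>a \<in> x \<longleftrightarrow> a \<in> x \<or> (\<exists>y. full y \<and> x \<prec> y \<and> a \<in> y)"
    proof
      assume "\<diamond>a \<in> x"
      then show "a \<in> x \<or> (\<exists>y. full y \<and> x \<prec> y \<and> a \<in> y)"
        using ex_prec Dia.prems Poss by metis
    next
      \<comment> \<open>Reflexivity of \<open>\<rightarrow>\<close> puts the diamond into a point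
        with \<open>a\<close>, and the last conjunct of \<open>\<prec>\<close> carries it down to
        \<open>x\<close>.\<close>
      have refl: "\<diamond>a \<in> y" if "mcs y" "a \<in> y" for y
        using R_refl that mcs_Dia by blast
      assume "a \<in> x \<or> (\<exists>y. full y \<and> x \<prec> y \<and> a \<in> y)"
      then show "\<diamond>a \<in> x"
      proof (elim disjE exE conjE)
        fix y assume "full y" "x \<prec> y" "a \<in> y"
        then have "\<diamond>a \<in> y" using refl unfolding full_def by blast
        then show ?thesis using \<open>x \<prec> y\<close> Dia.prems(1) Poss unfolding prec_def by blast
      qed (rule refl[OF x])
    qed
    then show ?thesis
      unfolding Poss plus_trans.simps sat.simps frame_simps
      using IH Dia.prems(2) by blast
  next
    case Exi
    show ?thesis
      unfolding Exi plus_trans.simps sat.simps frame_simps mcs_Dia[OF x]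
      using IH full_E[OF Dia.prems(2)] by blast
  qed
qed (auto simp: full_def)

lemma plus_trans_reflects:
  assumes "\<phi> \<in> \<Sigma>" "plus_trans \<phi> \<in> MGLB"
  shows "\<phi> \<in> L"
proof (rule ccontr)
  assume "\<phi> \<notin> L"
  then obtain x where x: "mcs x" "\<phi> \<notin> x" using mem_L_iff by blast
  \<comment> \<open>The refuting point \<open>x\<close> is exchanged for a point \<open>y\<close> of
    the same type in a full cluster; \<open>y\<close> also lacks \<open>\<phi>\<close>, which lies
    in \<open>\<Sigma>\<close>.\<close>
  obtain d where d: "ctp d = ctp x" "full d" using ex_full[OF x(1)] .
  obtain y where y: "d \<sim> y" "tp y = tp x"
    using tp_in_ctp[OF E_refl[OF x(1)]] d(1) ctpE by metis
  have "full y" using full_E[OF d(2) y(1)] .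
  have "valid {x. full x} frame (plus_trans \<phi>)"
    using assms(2)
  proof (rule MGLB_sound)
    show "wf {(y, x). x \<in> {x. full x} \<and> y \<in> {x. full x} \<and> frame Poss x y}"
      using prec_wf by (rule wf_subset) auto
    show "equiv {x. full x} {(x, y). x \<in> {x. full x} \<and> y \<in> {x. full x} \<and> frame Exi x y}"
      (is "equiv _ ?E")
    proof (rule equivI)
      show "refl_on {x. full x} ?E"
        by (rule refl_onI) (simp add: E_refl full_def)
      show "sym ?E"
        by (rule symI) (simp add: E_sym)
      show "trans ?E"
        by (rule transI, clarsimp) (rule E_trans)
    qed auto
  next
    fix x y z assume "frame Poss x y" "frame Poss y z"
    then show "frame Poss x z" using prec_trans by simp
  next
    fix x y z
    assume z: "z \<in> {x. full x}" and "frame Exi x y" "frame Poss y z"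
    then have "x \<sim> y" "y \<prec> z" by simp_all
    then obtain w where w: "x \<prec> w" "w \<sim> z" by (rule E_prec)
    then have "full w" using z full_E[OF _ E_sym] by blast
    then show "\<exists>w\<in>{x. full x}. frame Poss x w \<and> frame Exi w z"
      using w by auto
  next
    fix x y z
    assume x: "x \<in> {x. full x}" and "frame Poss x y" "frame Exi y z"
    then have "x \<prec> y" "y \<sim> z" by simp_all
    then obtain w where w: "x \<sim> w" "w \<prec> z" by (rule prec_E)
    then have "full w" using x full_E by blast
    then show "\<exists>w\<in>{x. full x}. frame Exi x w \<and> frame Poss w z"
      using w by auto
  qed
  then have "\<phi> \<in> y"
    using plus_trans_truth[OF assms(1) \<open>full y\<close>] \<open>full y\<close> unfolding valid_def by blast
  then show False using tp_mem[OF y(2) assms(1)] x(2) by blast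
qed

end

section \<open>Subformulae, and the theorem\<close>

primrec subfms :: "'m fm \<Rightarrow> 'm fm set" where
  "subfms (Var n) = {Var n}"
| "subfms Bot = {Bot}"
| "subfms (a \<^bold>\<longrightarrow> b) = insert (a \<^bold>\<longrightarrow> b) (subfms a \<union> subfms b)"
| "subfms (Dia m a) = insert (Dia m a) (subfms a)"

lemma subfms_refl: "a \<in> subfms a"
  by (cases a) auto

lemma subfms_Imp: "a \<^bold>\<longrightarrow> b \<in> subfms c \<Longrightarrow> a \<in> subfms c \<and> b \<in> subfms c"
  by (induction c) (auto simp: subfms_refl)

lemma subfms_Dia: "Dia m a \<in> subfms c \<Longrightarrow> a \<in> subfms c"
  by (induction c) (auto simp: subfms_refl)

lemma finite_subfms: "finite (subfms a)"
  by (induction a) auto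

theorem theorem5p6:
  fixes \<phi> :: bfm
  shows "\<phi> \<in> MplusGrzB \<longleftrightarrow> plus_trans \<phi> \<in> MGLB"
proof
  assume "\<phi> \<in> MplusGrzB"
  then show "plus_trans \<phi> \<in> MGLB" by (rule plus_trans_MplusGrzB)
next
  interpret grzb_types MplusGrzB "subfms \<phi>"
    by unfold_locales (auto simp: finite_subfms dest: subfms_Imp subfms_Dia)
  assume "plus_trans \<phi> \<in> MGLB"
  then show "\<phi> \<in> MplusGrzB" using plus_trans_reflects subfms_refl by blast
qed

end
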